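(* Let $\mathcal{G}$ be an ultragraph and $K$ a field. Then $L_K(\mathcal{G})$ is a prime ring if and only if $\mathcal{G}$ is downward directed.
   Context: An ultragraph $\mathcal{G}=(G^0,\mathcal{G}^1,r,s)$ consists of a countable set $G^0$ of vertices, a countable set $\mathcal{G}^1$ of edges, and maps $s:\mathcal{G}^1\to G^0$, $r:\mathcal{G}^1\to\mathcal{P}(G^0)\setminus\{\varnothing\}$. A vertex $v$ is regular if $0<|s^{-1}(v)|<\infty$. $\mathcal{G}^0$ denotes the smallest subset of $\mathcal{P}(G^0)$ that contains $\{v\}$ for all $v\in G^0$, contains $r(e)$ for all $e\in\mathcal{G}^1$, and is closed under relative complements, finite unions and finite intersections. A path of length $n\ge1$ is a sequence $\alpha=\alpha_1\cdots\alpha_n$ of edges with $s(\alpha_{i+1})\in r(\alpha_i)$ for $1\le i\le n-1$; $s(\alpha)=s(\alpha_1)$, $r(\alpha)=r(\alpha_n)$. Elements $A\in\mathcal{G}^0$ are paths of length $0$ with $s(A)=r(A)=A$. For vertices $v,w\in G^0$ write $v\ge w$ if there is a finite path $p$ with $s(p)=v$ and $w\in r(p)$ (length $0$ is allowed, so $v\ge v$). $\mathcal{G}$ is downward directed if for any $v,w\in G^0$ there is $u\in G^0$ with $v\ge u$ and $w\ge u$. For a field $K$, $L_K(\mathcal{G})$ is the (associative, not necessarily unital) $K$-algebra generated by $\{s_e,s_e^*\mid e\in\mathcal{G}^1\}\cup\{p_A\mid A\in\mathcal{G}^0\}$ subject to the relations, for all $A,B\in\mathcal{G}^0$, $e,f\in\mathcal{G}^1$: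 (1) $p_\varnothing=0$, $p_Ap_B=p_{A\cap B}$, $p_{A\cup B}=p_A+p_B-p_{A\cap B}$; (2) $p_{s(e)}s_e=s_e=s_ep_{r(e)}$ and $p_{r(e)}s_e^*=s_e^*=s_e^*p_{s(e)}$; (3) $s_e^*s_f=\delta_{e,f}p_{r(e)}$; (4) $p_v=\sum_{s(e)=v}s_es_e^*$ for every regular vertex $v$, where $p_v:=p_{\{v\}}$. *)

theory Defs
  imports
    "HOL-Algebra.QuotRing"
    "HOL-Algebra.Ideal_Product"
    "HOL-Algebra.Module"
    "HOL-Library.Poly_Mapping"
    "HOL-Library.Countable_Set"
begin

section \<open>Ultragraphs\<close>

record ('v, 'e) ultragraph =
  verts :: "'v set"
  edges :: "'e set"
  ug_source :: "'e \<Rightarrow> 'v"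
  ug_range :: "'e \<Rightarrow> 'v set"

locale ultragraph =
  fixes \<G> :: "('v, 'e) ultragraph"
  assumes countable_verts: "countable (verts \<G>)"
    and countable_edges: "countable (edges \<G>)"
    and source_in_verts: "e \<in> edges \<G> \<Longrightarrow> ug_source \<G> e \<in> verts \<G>"
    and range_subset: "e \<in> edges \<G> \<Longrightarrow> ug_range \<G> e \<subseteq> verts \<G>"
    and range_nonempty: "e \<in> edges \<G> \<Longrightarrow> ug_range \<G> e \<noteq> {}"

definition regular_vertex :: "('v, 'e) ultragraph \<Rightarrow> 'v \<Rightarrow> bool" where
  "regular_vertex \<G> v \<longleftrightarrow> v \<in> verts \<G> \<and>
     finite {e \<in> edges \<G>. ug_source \<G> e = v} \<and> {e \<in> edges \<G>. ug_source \<G> e = v} \<noteq> {}"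

text \<open>The empty set is the union of the empty family; it needs its own rule only when there are
  no vertices, since otherwise it arises as a relative complement.\<close>

inductive_set gen_verts :: "('v, 'e) ultragraph \<Rightarrow> 'v set set" for \<G> where
  empty: "{} \<in> gen_verts \<G>"
| vertex: "v \<in> verts \<G> \<Longrightarrow> {v} \<in> gen_verts \<G>"
| range: "e \<in> edges \<G> \<Longrightarrow> ug_range \<G> e \<in> gen_verts \<G>"
| diff: "A \<in> gen_verts \<G> \<Longrightarrow> B \<in> gen_verts \<G> \<Longrightarrow> A - B \<in> gen_verts \<G>"
| union: "A \<in> gen_verts \<G> \<Longrightarrow> B \<in> gen_verts \<G> \<Longrightarrow> A \<union> B \<in> gen_verts \<G>"
| inter: "A \<in> gen_verts \<G> \<Longrightarrow> B \<in> gen_verts \<G> \<Longrightarrow> A \<inter> B \<in> gen_verts \<G>"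

definition edge_path :: "('v, 'e) ultragraph \<Rightarrow> 'e list \<Rightarrow> bool" where
  "edge_path \<G> \<alpha> \<longleftrightarrow> \<alpha> \<noteq> [] \<and> set \<alpha> \<subseteq> edges \<G> \<and>
     (\<forall>i. Suc i < length \<alpha> \<longrightarrow> ug_source \<G> (\<alpha> ! Suc i) \<in> ug_range \<G> (\<alpha> ! i))"

text \<open>The disjunct \<open>v = w\<close> accounts for paths of length \<open>0\<close>: such a path with source \<open>v\<close> is the
  generalized vertex \<open>{v}\<close>, whose range is \<open>{v}\<close>.\<close>

definition reaches :: "('v, 'e) ultragraph \<Rightarrow> 'v \<Rightarrow> 'v \<Rightarrow> bool" where
  "reaches \<G> v w \<longleftrightarrow> v = w \<or>
     (\<exists>\<alpha>. edge_path \<G> \<alpha> \<and> ug_source \<G> (hd \<alpha>) = v \<and> w \<in> ug_range \<G> (last \<alpha>))"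

definition downward_directed :: "('v, 'e) ultragraph \<Rightarrow> bool" where
  "downward_directed \<G> \<longleftrightarrow>
     (\<forall>v\<in>verts \<G>. \<forall>w\<in>verts \<G>. \<exists>u\<in>verts \<G>. reaches \<G> v u \<and> reaches \<G> w u)"


section \<open>Prime rings without a unit assumption\<close>

text \<open>Rings here are carried by the record type of HOL-Algebra, but the locale \<open>ring\<close> would
  demand a unit; the \<open>one\<close> field is ignored throughout.\<close>

locale nonunital_ring = abelian_group R for R (structure) +
  assumes nu_m_closed: "x \<in> carrier R \<Longrightarrow> y \<in> carrier R \<Longrightarrow> x \<otimes> y \<in> carrier R"
    and nu_m_assoc: "x \<in> carrier R \<Longrightarrow> y \<in> carrier R \<Longrightarrow> z \<in> carrier R \<Longrightarrow>
      (x \<otimes> y) \<otimes> z = x \<otimes> (y \<otimes> z)"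
    and nu_l_distr: "x \<in> carrier R \<Longrightarrow> y \<in> carrier R \<Longrightarrow> z \<in> carrier R \<Longrightarrow>
      (x \<oplus> y) \<otimes> z = x \<otimes> z \<oplus> y \<otimes> z"
    and nu_r_distr: "x \<in> carrier R \<Longrightarrow> y \<in> carrier R \<Longrightarrow> z \<in> carrier R \<Longrightarrow>
      z \<otimes> (x \<oplus> y) = z \<otimes> x \<oplus> z \<otimes> y"

definition two_sided_ideal :: "('a, 'm) ring_scheme \<Rightarrow> 'a set \<Rightarrow> bool" where
  "two_sided_ideal R I \<longleftrightarrow> additive_subgroup I R \<and>
     (\<forall>a\<in>I. \<forall>x\<in>carrier R. x \<otimes>\<^bsub>R\<^esub> a \<in> I \<and> a \<otimes>\<^bsub>R\<^esub> x \<in> I)"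

text \<open>The zero ring counts as prime; it occurs as the algebra of the empty ultragraph.\<close>

definition prime_ring :: "('a, 'm) ring_scheme \<Rightarrow> bool" where
  "prime_ring R \<longleftrightarrow> nonunital_ring R \<and>
     (\<forall>I J. two_sided_ideal R I \<longrightarrow> two_sided_ideal R J \<longrightarrow> I \<cdot>\<^bsub>R\<^esub> J = {\<zero>\<^bsub>R\<^esub>} \<longrightarrow>
        I = {\<zero>\<^bsub>R\<^esub>} \<or> J = {\<zero>\<^bsub>R\<^esub>})"


section \<open>The ultragraph Leavitt path algebra\<close>

datatype ('v, 'e) lpa_gen = Edge 'e | Ghost 'e | Proj "'v set"

text \<open>With words as a monoid under concatenation, \<open>'x list \<Rightarrow>\<^sub>0 'k\<close> is the unital free
  algebra over \<open>'k\<close> on the type \<open>'x\<close>.\<close>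

instantiation list :: (type) monoid_add
begin
definition zero_list :: "'a list" where "zero_list = []"
definition plus_list :: "'a list \<Rightarrow> 'a list \<Rightarrow> 'a list" where "plus_list = (@)"
instance by standard (simp_all add: zero_list_def plus_list_def)
end

text \<open>The non-unital free algebra on \<open>X\<close> is spanned by the nonempty words over \<open>X\<close>; in
  particular its \<open>one\<close> field is not an element of the carrier.\<close>

definition free_algebra :: "'x set \<Rightarrow> ('k::field, 'x list \<Rightarrow>\<^sub>0 'k) module" where
  "free_algebra X =
     \<lparr>carrier = {f. Poly_Mapping.keys f \<subseteq> lists X - {[]}}, mult = (*), one = 1, zero = 0, add = (+),
      smult = (\<lambda>c f. Poly_Mapping.single [] c * f)\<rparr>"

definition generated_ideal ::
  "('k, 'a, 'm) module_scheme \<Rightarrow> 'a set \<Rightarrow> 'a set" where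
  "generated_ideal A S = \<Inter>{I. two_sided_ideal A I \<and> (\<forall>c. \<forall>a\<in>I. c \<odot>\<^bsub>A\<^esub> a \<in> I) \<and> S \<subseteq> I}"

definition lpa_gens :: "('v, 'e) ultragraph \<Rightarrow> ('v, 'e) lpa_gen set" where
  "lpa_gens \<G> = Edge ` edges \<G> \<union> Ghost ` edges \<G> \<union> Proj ` gen_verts \<G>"

definition gen :: "'x \<Rightarrow> ('x list \<Rightarrow>\<^sub>0 'k::field)" where
  "gen x = Poly_Mapping.single [x] 1"

abbreviation "sE e \<equiv> gen (Edge e)"
abbreviation "sG e \<equiv> gen (Ghost e)"
abbreviation "pP A \<equiv> gen (Proj A)"

text \<open>A defining relation \<open>x = y\<close> is recorded as the element \<open>x - y\<close>.\<close>

definition lpa_relators ::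
  "('v, 'e) ultragraph \<Rightarrow> (('v, 'e) lpa_gen list \<Rightarrow>\<^sub>0 'k::field) set" where
  "lpa_relators \<G> =
     {pP {}}
   \<union> {pP A * pP B - pP (A \<inter> B) | A B. A \<in> gen_verts \<G> \<and> B \<in> gen_verts \<G>}
   \<union> {pP (A \<union> B) - (pP A + pP B - pP (A \<inter> B)) | A B. A \<in> gen_verts \<G> \<and> B \<in> gen_verts \<G>}
   \<union> {pP {ug_source \<G> e} * sE e - sE e | e. e \<in> edges \<G>}
   \<union> {sE e * pP (ug_range \<G> e) - sE e | e. e \<in> edges \<G>}
   \<union> {pP (ug_range \<G> e) * sG e - sG e | e. e \<in> edges \<G>}
   \<union> {sG e * pP {ug_source \<G> e} - sG e | e. e \<in> edges \<G>}
   \<union> {sG e * sE f - (if e = f then pP (ug_range \<G> e) else 0) | e f. e \<in> edges \<G> \<and> f \<in> edges \<G>}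
   \<union> {pP {v} - (\<Sum>e | e \<in> edges \<G> \<and> ug_source \<G> e = v. sE e * sG e) | v. regular_vertex \<G> v}"

definition lpa_free ::
  "('v, 'e) ultragraph \<Rightarrow> ('k::field, ('v, 'e) lpa_gen list \<Rightarrow>\<^sub>0 'k) module" where
  "lpa_free \<G> = free_algebra (lpa_gens \<G>)"

definition lpa_ideal ::
  "('v, 'e) ultragraph \<Rightarrow> (('v, 'e) lpa_gen list \<Rightarrow>\<^sub>0 'k::field) set" where
  "lpa_ideal \<G> = generated_ideal (lpa_free \<G>) (lpa_relators \<G>)"

text \<open>The underlying ring of the Leavitt path algebra; the field \<open>K\<close> is the type \<open>'k\<close>.\<close>

definition leavitt_path_algebra ::
  "('v, 'e) ultragraph \<Rightarrow> (('v, 'e) lpa_gen list \<Rightarrow>\<^sub>0 'k::field) set ring" where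
  "leavitt_path_algebra \<G> = lpa_free \<G> Quot lpa_ideal \<G>"


section \<open>The Leavitt path algebra is a ring\<close>

lemma quot_nonunital_ring:
  assumes R: "nonunital_ring R" and I: "two_sided_ideal R I"
  shows "nonunital_ring (R Quot I)"
proof -
  interpret nonunital_ring R by (rule R)
  interpret additive_subgroup I R using I by (simp add: two_sided_ideal_def)
  interpret abelian_subgroup I R
    by (rule abelian_subgroupI3) (rule is_additive_subgroup, rule abelian_group_axioms)
  have lI: "x \<otimes>\<^bsub>R\<^esub> a \<in> I" and rI: "a \<otimes>\<^bsub>R\<^esub> x \<in> I" if "a \<in> I" "x \<in> carrier R" for a x
    using I that by (auto simp: two_sided_ideal_def)
  have sub: "subgroup I (add_monoid R)" by (rule a_subgroup)
  have coset_eq: "I +>\<^bsub>R\<^esub> (a \<otimes>\<^bsub>R\<^esub> b) = I +>\<^bsub>R\<^esub> (x \<otimes>\<^bsub>R\<^esub> y)"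
    if x: "x \<in> carrier R" and y: "y \<in> carrier R"
      and a: "a \<in> I +>\<^bsub>R\<^esub> x" and b: "b \<in> I +>\<^bsub>R\<^esub> y" for a b x y
  proof -
    obtain i where i: "i \<in> I" "a = i \<oplus>\<^bsub>R\<^esub> x" using a by (auto simp: a_r_coset_def')
    obtain j where j: "j \<in> I" "b = j \<oplus>\<^bsub>R\<^esub> y" using b by (auto simp: a_r_coset_def')
    have ic: "i \<in> carrier R" "j \<in> carrier R" using i j a_subset by auto
    have "a \<otimes>\<^bsub>R\<^esub> b = (i \<otimes>\<^bsub>R\<^esub> b \<oplus>\<^bsub>R\<^esub> x \<otimes>\<^bsub>R\<^esub> j) \<oplus>\<^bsub>R\<^esub> x \<otimes>\<^bsub>R\<^esub> y"
      using i j ic x y by (simp add: nu_l_distr nu_r_distr nu_m_closed a_assoc a_lcomm)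
    moreover have "i \<otimes>\<^bsub>R\<^esub> b \<oplus>\<^bsub>R\<^esub> x \<otimes>\<^bsub>R\<^esub> j \<in> I"
      using i j ic x y by (intro a_closed) (auto intro: lI rI)
    ultimately have "a \<otimes>\<^bsub>R\<^esub> b \<in> I +>\<^bsub>R\<^esub> (x \<otimes>\<^bsub>R\<^esub> y)" by (auto simp: a_r_coset_def')
    from a_repr_independence[OF this _ sub] x y show ?thesis by (simp add: nu_m_closed)
  qed
  have mult: "rcoset_mult R I (I +>\<^bsub>R\<^esub> x) (I +>\<^bsub>R\<^esub> y) = I +>\<^bsub>R\<^esub> (x \<otimes>\<^bsub>R\<^esub> y)"
    if "x \<in> carrier R" "y \<in> carrier R" for x y
  proof -
    have "x \<in> I +>\<^bsub>R\<^esub> x" "y \<in> I +>\<^bsub>R\<^esub> y" using that a_rcos_self by auto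
    then show ?thesis unfolding rcoset_mult_def using coset_eq[OF that] by blast
  qed
  have grp: "comm_group (A_FactGroup R I)" by (rule a_factorgroup_is_comm_group)
  have add: "set_add R (I +>\<^bsub>R\<^esub> x) (I +>\<^bsub>R\<^esub> y) = I +>\<^bsub>R\<^esub> (x \<oplus>\<^bsub>R\<^esub> y)"
    if "x \<in> carrier R" "y \<in> carrier R" for x y
    using that by (rule a_rcos_sum)
  have carr: "X \<in> a_rcosets\<^bsub>R\<^esub> I \<longleftrightarrow> (\<exists>x\<in>carrier R. X = I +>\<^bsub>R\<^esub> x)" for X
    by (auto simp: A_RCOSETS_def')
  have "abelian_group (R Quot I)"
  proof (rule comm_group_abelian_groupI)
    have "add_monoid (R Quot I) = A_FactGroup R I"
      by (simp add: FactRing_def A_FactGroup_def FactGroup_def A_RCOSETS_def set_add_def)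
    then show "comm_group (add_monoid (R Quot I))" using grp by simp
  qed
  then show ?thesis
    unfolding nonunital_ring_def nonunital_ring_axioms_def
    by (auto simp: FactRing_def carr mult add nu_m_closed nu_m_assoc nu_l_distr nu_r_distr)
qed

lemma keys_mult_words:
  "Poly_Mapping.keys (f * g) \<subseteq> {u @ v | u v. u \<in> Poly_Mapping.keys f \<and> v \<in> Poly_Mapping.keys g}"
  for f g :: "'x list \<Rightarrow>\<^sub>0 'k::field"
  using keys_mult[of f g] by (auto simp: plus_list_def)

lemma free_algebra_nonunital_ring: "nonunital_ring (free_algebra X)"
proof -
  have neg: "\<exists>y\<in>carrier (free_algebra X). y + x = 0"
    if "x \<in> carrier (free_algebra X)" for x :: "'a list \<Rightarrow>\<^sub>0 'b::field"
    by (rule bexI[of _ "- x"]) (use that in \<open>auto simp: free_algebra_def\<close>)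
  have "abelian_group (free_algebra X :: ('b::field, 'a list \<Rightarrow>\<^sub>0 'b) module)"
    by (rule abelian_groupI)
      (use neg keys_add in \<open>fastforce simp: free_algebra_def add.assoc add.commute\<close>)+
  moreover have "f * g \<in> carrier (free_algebra X)"
    if "f \<in> carrier (free_algebra X)" "g \<in> carrier (free_algebra X)"
    for f g :: "'a list \<Rightarrow>\<^sub>0 'b::field"
    using that keys_mult_words[of f g] by (fastforce simp: free_algebra_def)
  ultimately show ?thesis
    unfolding nonunital_ring_def nonunital_ring_axioms_def
    by (auto simp: free_algebra_def mult.assoc distrib_left distrib_right)
qed

lemma two_sided_ideal_generated_ideal:
  assumes A: "nonunital_ring A" and S: "S \<subseteq> carrier A"
    and c: "\<And>c a. a \<in> carrier A \<Longrightarrow> c \<odot>\<^bsub>A\<^esub> a \<in> carrier A"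
  shows "two_sided_ideal A (generated_ideal A S)"
proof -
  interpret nonunital_ring A by (rule A)
  define \<I> where "\<I> = {I. two_sided_ideal A I \<and> (\<forall>c. \<forall>a\<in>I. c \<odot>\<^bsub>A\<^esub> a \<in> I) \<and> S \<subseteq> I}"
  have "two_sided_ideal A (carrier A)"
    by (auto simp: two_sided_ideal_def nu_m_closed intro!: additive_subgroupI add.subgroup_self)
  then have ne: "\<I> \<noteq> {}" using S c by (auto simp: \<I>_def)
  have "subgroup (\<Inter>\<I>) (add_monoid A)"
    by (rule add.subgroups_Inter)
      (use ne in \<open>auto simp: \<I>_def two_sided_ideal_def additive_subgroup_def\<close>)
  moreover have "x \<otimes>\<^bsub>A\<^esub> a \<in> \<Inter>\<I> \<and> a \<otimes>\<^bsub>A\<^esub> x \<in> \<Inter>\<I>" if "a \<in> \<Inter>\<I>" "x \<in> carrier A" for a x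
    using that by (auto simp: \<I>_def two_sided_ideal_def)
  ultimately show ?thesis
    by (auto simp: two_sided_ideal_def generated_ideal_def \<I>_def additive_subgroup_def)
qed

lemma free_algebra_closed:
  fixes f g :: "'x list \<Rightarrow>\<^sub>0 'k::field"
  shows "x \<in> X \<Longrightarrow> (gen x :: 'x list \<Rightarrow>\<^sub>0 'k) \<in> carrier (free_algebra X)"
    and "0 \<in> carrier (free_algebra X :: ('k, 'x list \<Rightarrow>\<^sub>0 'k) module)"
    and "f \<in> carrier (free_algebra X) \<Longrightarrow> g \<in> carrier (free_algebra X) \<Longrightarrow>
      f + g \<in> carrier (free_algebra X)"
    and "f \<in> carrier (free_algebra X) \<Longrightarrow> g \<in> carrier (free_algebra X) \<Longrightarrow>
      f - g \<in> carrier (free_algebra X)"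
    and "f \<in> carrier (free_algebra X) \<Longrightarrow> g \<in> carrier (free_algebra X) \<Longrightarrow>
      f * g \<in> carrier (free_algebra X)"
    and "f \<in> carrier (free_algebra X) \<Longrightarrow> c \<odot>\<^bsub>free_algebra X\<^esub> f \<in> carrier (free_algebra X)"
proof -
  show "f * g \<in> carrier (free_algebra X)"
    if "f \<in> carrier (free_algebra X)" "g \<in> carrier (free_algebra X)"
    using that keys_mult_words[of f g] by (fastforce simp: free_algebra_def)
  show "c \<odot>\<^bsub>free_algebra X\<^esub> f \<in> carrier (free_algebra X)"
    if "f \<in> carrier (free_algebra X)"
    using that keys_mult_words[of "Poly_Mapping.single [] c" f]
    by (fastforce simp: free_algebra_def split: if_splits)
qed (use keys_add[of f g] keys_diff[of f g] in
    \<open>auto simp: free_algebra_def gen_def subset_iff split: if_splits\<close>)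

context ultragraph
begin

lemma lpa_relators_subset: "lpa_relators \<G> \<subseteq> carrier (lpa_free \<G>)"
proof -
  let ?C = "carrier (lpa_free \<G>)"
  have P: "pP A \<in> ?C" if "A \<in> gen_verts \<G>" for A
    unfolding lpa_free_def by (rule free_algebra_closed) (use that in \<open>simp add: lpa_gens_def\<close>)
  have E: "sE e \<in> ?C" and G: "sG e \<in> ?C" if "e \<in> edges \<G>" for e
    unfolding lpa_free_def
    by (rule free_algebra_closed; use that in \<open>simp add: lpa_gens_def\<close>)+
  note cl = free_algebra_closed(2-5)[where X = "lpa_gens \<G>", folded lpa_free_def]
  have S: "(\<Sum>e\<in>F. h e) \<in> ?C" if "\<And>e. e \<in> F \<Longrightarrow> h e \<in> ?C" for F h
    using that by (induction F rule: infinite_finite_induct) (auto intro: cl)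
  have gv: "{ug_source \<G> e} \<in> gen_verts \<G>" "ug_range \<G> e \<in> gen_verts \<G>"
    if "e \<in> edges \<G>" for e
    using that by (auto intro: gen_verts.intros source_in_verts)
  show ?thesis
    unfolding lpa_relators_def
    by (auto intro!: cl P E G S gv gen_verts.intros simp: regular_vertex_def source_in_verts)
qed

lemma two_sided_ideal_lpa_ideal: "two_sided_ideal (lpa_free \<G>) (lpa_ideal \<G>)"
  unfolding lpa_ideal_def
  by (rule two_sided_ideal_generated_ideal)
    (simp_all add: lpa_relators_subset, simp_all add: lpa_free_def free_algebra_nonunital_ring
      free_algebra_closed)

lemma leavitt_path_algebra_nonunital_ring: "nonunital_ring (leavitt_path_algebra \<G>)"
  unfolding leavitt_path_algebra_def
  by (rule quot_nonunital_ring)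
    (simp_all add: two_sided_ideal_lpa_ideal, simp add: lpa_free_def free_algebra_nonunital_ring)

end

end

theory Submission
  imports Defs
begin

text \<open>
  Write \<open>L\<close> for the algebra, and call the span of the elements \<open>s\<^sub>\<alpha> p\<^sub>A\<close> its real part. The edges act
  on a set of points over the vertices, graded by the integers: every edge \<open>e\<close> embeds the points
  over its range into those over its source, raising the degree by one. The resulting
  representation of \<open>L\<close> on functions shows that the elements \<open>s\<^sub>\<alpha> p\<^sub>v\<close> are linearly independent.

  If \<open>x\<close> and \<open>y\<close> are nonzero elements of \<open>L\<close>, then some right multiples \<open>x b\<close> and \<open>y d\<close> are nonzero
  and real, involving paths that end at vertices \<open>v\<close> and \<open>w\<close>. Downward directedness lets both be
  moved to a common vertex \<open>u\<close>. For a path \<open>\<beta>\<close> of minimal length in \<open>y d\<close> the product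
  \<open>x b p\<^sub>u s\<^sub>\<beta>\<^sup>* y d\<close> has a nonzero term of lowest degree, so \<open>x L y\<close> is nonzero. Conversely, if
  \<open>v\<close> and \<open>w\<close> have no common descendant then \<open>p\<^sub>v L p\<^sub>w = 0\<close>, although \<open>p\<^sub>v\<close> and \<open>p\<^sub>w\<close> are nonzero.
\<close>

section \<open>Prime rings and quotients\<close>

text \<open>The representation is a branching system: the points over the ranges of the edges
  emitted by a vertex are copied disjointly into the points over that vertex. The degree is there
  because of cycles. Without it, a loop \<open>e\<close> with range \<open>{v}\<close> at a vertex
  \<open>v\<close> that emits nothing else would only permute the points over \<open>v\<close>,
  possibly trivially, and \<open>s_e - p_v\<close> could act as zero. With it, paths of different
  lengths are separated.

  The factor \<open>s\<^sub>\<beta>\<^sup>*\<close> is needed because the paths in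
  \<open>y d\<close> end at \<open>u\<close> but may start anywhere: it cancels \<beta> on the left
  and turns the shortest term at \<open>u\<close> into a multiple of \<open>p\<^sub>u\<close>, which
  then meets the terms of \<open>x b\<close> that end at \<open>u\<close>.

  For the converse, between \<open>p\<^sub>v\<close> and \<open>p\<^sub>w\<close> a term
  \<open>s\<^sub>\<alpha> p\<^sub>A s\<^sub>\<beta>\<^sup>*\<close> survives only if \<alpha> leaves
  \<open>v\<close> and \<beta> leaves \<open>w\<close>, and a vertex of \<open>A\<close> in both
  ranges would be a common descendant. As \<open>L\<close> may lack a unit, the passage from
  \<open>p\<^sub>v L p\<^sub>w = 0\<close> to ideals with zero product rests on
  \<open>p\<^sub>v\<close> being idempotent.\<close>

context nonunital_ring
begin

lemma nu_zero [simp]: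
  assumes "x \<in> carrier R"
  shows "\<zero> \<otimes> x = \<zero>" "x \<otimes> \<zero> = \<zero>"
proof -
  have "\<zero> \<otimes> x \<oplus> \<zero> \<otimes> x = \<zero> \<otimes> x"
    using nu_l_distr[of \<zero> \<zero> x] assms by simp
  then show "\<zero> \<otimes> x = \<zero>"
    using assms by (simp add: nu_m_closed)
  have "x \<otimes> \<zero> \<oplus> x \<otimes> \<zero> = x \<otimes> \<zero>"
    using nu_r_distr[of \<zero> \<zero> x] assms by simp
  then show "x \<otimes> \<zero> = \<zero>"
    using assms by (simp add: nu_m_closed)
qed

lemma nu_minus:
  assumes "x \<in> carrier R" "y \<in> carrier R"
  shows "(\<ominus> x) \<otimes> y = \<ominus> (x \<otimes> y)" "y \<otimes> (\<ominus> x) = \<ominus> (y \<otimes> x)"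
proof -
  have "(\<ominus> x) \<otimes> y \<oplus> x \<otimes> y = \<zero>"
    using assms by (simp add: nu_l_distr[symmetric] l_neg)
  then show "(\<ominus> x) \<otimes> y = \<ominus> (x \<otimes> y)"
    using assms by (simp add: nu_m_closed minus_equality)
  have "y \<otimes> (\<ominus> x) \<oplus> y \<otimes> x = \<zero>"
    using assms by (simp add: nu_r_distr[symmetric] l_neg)
  then show "y \<otimes> (\<ominus> x) = \<ominus> (y \<otimes> x)"
    using assms by (simp add: nu_m_closed minus_equality)
qed

lemma two_sided_idealI:
  assumes "I \<subseteq> carrier R" and "\<zero> \<in> I" and "\<And>x y. x \<in> I \<Longrightarrow> y \<in> I \<Longrightarrow> x \<oplus> y \<in> I"
    and "\<And>x. x \<in> I \<Longrightarrow> \<ominus> x \<in> I"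
    and "\<And>a x. a \<in> I \<Longrightarrow> x \<in> carrier R \<Longrightarrow> x \<otimes> a \<in> I"
    and "\<And>a x. a \<in> I \<Longrightarrow> x \<in> carrier R \<Longrightarrow> a \<otimes> x \<in> I"
  shows "two_sided_ideal R I"
proof -
  have "subgroup I (add_monoid R)"
    using assms by (intro add.subgroupI) (auto simp: a_inv_def)
  then show ?thesis
    using assms by (auto simp: two_sided_ideal_def additive_subgroup_def)
qed

text \<open>If \<open>I\<close> and \<open>J\<close> have zero product, elements \<open>x\<close> of
  \<open>I\<close> and \<open>y\<close> of \<open>J\<close> satisfy both \<open>x y = 0\<close> and
  \<open>x a y = 0\<close>. Without a unit the first is not an instance of the second, so the
  criterion offers both as hypotheses.\<close>

lemma prime_ringI:
  assumes "\<And>x y. x \<in> carrier R \<Longrightarrow> y \<in> carrier R \<Longrightarrow> x \<otimes> y = \<zero> \<Longrightarrow>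
      (\<And>a. a \<in> carrier R \<Longrightarrow> (x \<otimes> a) \<otimes> y = \<zero>) \<Longrightarrow> x = \<zero> \<or> y = \<zero>"
  shows "prime_ring R"
  unfolding prime_ring_def
proof (intro conjI allI impI)
  show "nonunital_ring R" by (rule nonunital_ring_axioms)
  fix I J assume I: "two_sided_ideal R I" and J: "two_sided_ideal R J" and IJ: "I \<cdot> J = {\<zero>}"
  interpret I: additive_subgroup I R using I by (simp add: two_sided_ideal_def)
  interpret J: additive_subgroup J R using J by (simp add: two_sided_ideal_def)
  have "x = \<zero> \<or> y = \<zero>" if "x \<in> I" "y \<in> J" for x y
  proof (rule assms)
    show "x \<in> carrier R" "y \<in> carrier R" using that by auto
    show "x \<otimes> y = \<zero>" using that IJ ideal_prod.prod[of x I y J R] by auto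
    show "(x \<otimes> a) \<otimes> y = \<zero>" if "a \<in> carrier R" for a
      using that \<open>x \<in> I\<close> \<open>y \<in> J\<close> I IJ ideal_prod.prod[of "x \<otimes> a" I y J R]
      by (auto simp: two_sided_ideal_def)
  qed
  then show "I = {\<zero>} \<or> J = {\<zero>}"
    using I.zero_closed J.zero_closed by blast
qed

text \<open>Annihilators replace the ideals generated by \<open>x\<close> and \<open>y\<close>,
  whose description is awkward without a unit: \<open>J\<close> is the right annihilator of
  \<open>x R\<close> and contains \<open>y\<close>, and \<open>I\<close> is the left annihilator of
  \<open>J\<close>. Idempotence puts \<open>x\<close> into \<open>I\<close>, since
  \<open>x j = (x x) j = 0\<close> for \<open>j\<close> in \<open>J\<close>.\<close>

lemma prime_ring_idempotentD:
  assumes prime: "prime_ring R" and x: "x \<in> carrier R" "x \<otimes> x = x" and y: "y \<in> carrier R"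
    and 0: "\<And>a. a \<in> carrier R \<Longrightarrow> (x \<otimes> a) \<otimes> y = \<zero>"
  shows "x = \<zero> \<or> y = \<zero>"
proof -
  define J where "J = {z \<in> carrier R. \<forall>a\<in>carrier R. (x \<otimes> a) \<otimes> z = \<zero>}"
  define I where "I = {z \<in> carrier R. \<forall>j\<in>J. z \<otimes> j = \<zero>}"
  have Jc: "j \<in> carrier R" if "j \<in> J" for j using that by (simp add: J_def)
  have J: "two_sided_ideal R J"
  proof (rule two_sided_idealI)
    fix a r assume a: "a \<in> J" and r: "r \<in> carrier R"
    have "(x \<otimes> b) \<otimes> (r \<otimes> a) = (x \<otimes> (b \<otimes> r)) \<otimes> a" if "b \<in> carrier R" for b
      using that x r Jc[OF a] by (simp add: nu_m_assoc nu_m_closed)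
    then show "r \<otimes> a \<in> J"
      using a r by (simp add: J_def nu_m_closed)
    have "(x \<otimes> b) \<otimes> (a \<otimes> r) = ((x \<otimes> b) \<otimes> a) \<otimes> r" if "b \<in> carrier R" for b
      using that x r Jc[OF a] by (simp add: nu_m_assoc nu_m_closed)
    then show "a \<otimes> r \<in> J"
      using a r by (simp add: J_def nu_m_closed)
  qed (use x in \<open>auto simp: J_def nu_r_distr nu_m_closed nu_minus\<close>)
  have I: "two_sided_ideal R I"
  proof (rule two_sided_idealI)
    fix a r assume a: "a \<in> I" and r: "r \<in> carrier R"
    have ac: "a \<in> carrier R" using a by (simp add: I_def)
    show "r \<otimes> a \<in> I"
      using a r ac Jc by (auto simp: I_def nu_m_closed nu_m_assoc)
    have "(a \<otimes> r) \<otimes> j = \<zero>" if "j \<in> J" for j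
    proof -
      have "r \<otimes> j \<in> J" using J that r by (auto simp: two_sided_ideal_def)
      then show ?thesis using a r ac Jc[OF that] by (simp add: I_def nu_m_assoc)
    qed
    then show "a \<otimes> r \<in> I"
      using r ac by (simp add: I_def nu_m_closed)
  next
    fix a b assume "a \<in> I" "b \<in> I"
    then show "a \<oplus> b \<in> I" using Jc by (simp add: I_def nu_l_distr)
  next
    fix a assume "a \<in> I"
    then show "\<ominus> a \<in> I" using Jc by (simp add: I_def nu_minus)
  next
    show "I \<subseteq> carrier R" unfolding I_def by blast
    show "\<zero> \<in> I" unfolding I_def using Jc nu_zero(1) by blast
  qed
  have "\<zero> \<in> I" "\<zero> \<in> J"
    using I J by (auto simp: two_sided_ideal_def intro: additive_subgroup.zero_closed)
  then have "\<zero> \<in> I \<cdot> J"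
    using ideal_prod.prod[of \<zero> I \<zero> J R] by simp
  moreover have "z \<in> {\<zero>}" if "z \<in> I \<cdot> J" for z
    using that by (induction rule: ideal_prod.induct) (auto simp: I_def)
  ultimately have "I \<cdot> J = {\<zero>}" by blast
  then have "I = {\<zero>} \<or> J = {\<zero>}"
    using prime I J by (auto simp: prime_ring_def)
  moreover have "y \<in> J" using y 0 by (simp add: J_def)
  moreover have "x \<otimes> j = \<zero>" if "j \<in> J" for j
    using that x by (auto simp: J_def)
  then have "x \<in> I" using x by (auto simp: I_def)
  ultimately show ?thesis by blast
qed

lemma quot_coset_eq_iff:
  assumes I: "two_sided_ideal R I" and x: "x \<in> carrier R"
  shows "I +> x = I \<longleftrightarrow> x \<in> I"
proof -
  interpret additive_subgroup I R using I by (simp add: two_sided_ideal_def)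
  interpret abelian_subgroup I R
    by (rule abelian_subgroupI3) (rule is_additive_subgroup, rule abelian_group_axioms)
  show ?thesis using x a_rcos_self[OF x] a_rcos_const by blast
qed

lemma quot_mult:
  assumes I: "two_sided_ideal R I" and x: "x \<in> carrier R" and y: "y \<in> carrier R"
  shows "(I +> x) \<otimes>\<^bsub>R Quot I\<^esub> (I +> y) = I +> (x \<otimes> y)"
proof -
  interpret additive_subgroup I R using I by (simp add: two_sided_ideal_def)
  interpret abelian_subgroup I R
    by (rule abelian_subgroupI3) (rule is_additive_subgroup, rule abelian_group_axioms)
  have mI: "z \<otimes> a \<in> I" "a \<otimes> z \<in> I" if "a \<in> I" "z \<in> carrier R" for a z
    using I that by (auto simp: two_sided_ideal_def)
  have "I +> (a \<otimes> b) = I +> (x \<otimes> y)" if a: "a \<in> I +> x" and b: "b \<in> I +> y" for a b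
  proof -
    obtain i where i: "i \<in> I" "a = i \<oplus> x" using a by (auto simp: a_r_coset_def')
    obtain j where j: "j \<in> I" "b = j \<oplus> y" using b by (auto simp: a_r_coset_def')
    have ij: "i \<in> carrier R" "j \<in> carrier R" using i j a_subset by auto
    have "a \<otimes> b = (i \<otimes> b \<oplus> x \<otimes> j) \<oplus> x \<otimes> y"
      using i j ij x y by (simp add: nu_l_distr nu_r_distr nu_m_closed a_assoc a_lcomm)
    moreover have "i \<otimes> b \<oplus> x \<otimes> j \<in> I"
      using i j ij x y by (intro a_closed) (auto intro: mI)
    ultimately have "a \<otimes> b \<in> I +> (x \<otimes> y)" by (auto simp: a_r_coset_def')
    from a_repr_independence[OF this _ a_subgroup] x y show ?thesis by (simp add: nu_m_closed)
  qed
  moreover have "x \<in> I +> x" "y \<in> I +> y" using x y a_rcos_self by auto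
  ultimately have "rcoset_mult R I (I +> x) (I +> y) = I +> (x \<otimes> y)"
    unfolding rcoset_mult_def by blast
  then show ?thesis by (simp add: FactRing_def)
qed

lemma quot_carrier: "carrier (R Quot I) = (+>) I ` carrier R"
  by (auto simp: FactRing_def A_RCOSETS_def')

lemma quot_prime_ringI:
  assumes I: "two_sided_ideal R I"
    and "\<And>x y. x \<in> carrier R \<Longrightarrow> y \<in> carrier R \<Longrightarrow> x \<otimes> y \<in> I \<Longrightarrow>
      (\<And>a. a \<in> carrier R \<Longrightarrow> (x \<otimes> a) \<otimes> y \<in> I) \<Longrightarrow> x \<in> I \<or> y \<in> I"
  shows "prime_ring (R Quot I)"
proof -
  interpret Q: nonunital_ring "R Quot I"
    by (rule quot_nonunital_ring[OF nonunital_ring_axioms I])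
  have zero: "\<zero>\<^bsub>R Quot I\<^esub> = I" by (simp add: FactRing_def)
  show ?thesis
  proof (rule Q.prime_ringI)
    fix X Y assume "X \<in> carrier (R Quot I)" and "Y \<in> carrier (R Quot I)"
    then obtain x y where xy: "x \<in> carrier R" "y \<in> carrier R" "X = I +> x" "Y = I +> y"
      by (auto simp: quot_carrier)
    assume "X \<otimes>\<^bsub>R Quot I\<^esub> Y = \<zero>\<^bsub>R Quot I\<^esub>"
      and a: "\<And>A. A \<in> carrier (R Quot I) \<Longrightarrow>
        X \<otimes>\<^bsub>R Quot I\<^esub> A \<otimes>\<^bsub>R Quot I\<^esub> Y = \<zero>\<^bsub>R Quot I\<^esub>"
    then have "x \<otimes> y \<in> I"
      using xy I by (simp add: quot_mult zero quot_coset_eq_iff nu_m_closed)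
    moreover have "(x \<otimes> b) \<otimes> y \<in> I" if "b \<in> carrier R" for b
      using a[of "I +> b"] that xy I
      by (simp add: quot_mult zero quot_coset_eq_iff nu_m_closed quot_carrier)
    ultimately show "X = \<zero>\<^bsub>R Quot I\<^esub> \<or> Y = \<zero>\<^bsub>R Quot I\<^esub>"
      using assms(2)[of x y] xy I by (simp add: zero quot_coset_eq_iff)
  qed
qed

lemma quot_prime_ring_idempotentD:
  assumes I: "two_sided_ideal R I" and prime: "prime_ring (R Quot I)"
    and x: "x \<in> carrier R" "x \<otimes> x \<in> I +> x" and y: "y \<in> carrier R"
    and a: "\<And>a. a \<in> carrier R \<Longrightarrow> (x \<otimes> a) \<otimes> y \<in> I"
  shows "x \<in> I \<or> y \<in> I"
proof -
  interpret Q: nonunital_ring "R Quot I"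
    by (rule quot_nonunital_ring[OF nonunital_ring_axioms I])
  have zero: "\<zero>\<^bsub>R Quot I\<^esub> = I" by (simp add: FactRing_def)
  interpret additive_subgroup I R using I by (simp add: two_sided_ideal_def)
  have "I +> (x \<otimes> x) = I +> x"
    using a_repr_independence[OF x(2) x(1) a_subgroup] by simp
  then have "I +> x = \<zero>\<^bsub>R Quot I\<^esub> \<or> I +> y = \<zero>\<^bsub>R Quot I\<^esub>"
  proof (intro Q.prime_ring_idempotentD[OF prime])
    fix A assume "A \<in> carrier (R Quot I)"
    then obtain b where b: "b \<in> carrier R" "A = I +> b" by (auto simp: quot_carrier)
    have "I +> ((x \<otimes> b) \<otimes> y) = I"
      using quot_coset_eq_iff[OF I] a[OF b(1)] b x y by (simp add: nu_m_closed)
    then show "(I +> x) \<otimes>\<^bsub>R Quot I\<^esub> A \<otimes>\<^bsub>R Quot I\<^esub> (I +> y) = \<zero>\<^bsub>R Quot I\<^esub>"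
      using b x y I by (simp add: quot_mult zero nu_m_closed)
  qed (use x(1) y I in \<open>auto simp: quot_mult quot_carrier\<close>)
  then show ?thesis using x y I by (simp add: zero quot_coset_eq_iff)
qed

end

section \<open>Computing modulo the relations\<close>

lemma poly_mapping_expand:
  "f = (\<Sum>w\<in>Poly_Mapping.keys f. Poly_Mapping.single w (Poly_Mapping.lookup f w))"
  by (rule poly_mapping_eqI)
    (simp add: lookup_sum lookup_single when_def in_keys_iff)

lemma poly_mapping_induct [case_names zero single add]:
  fixes f :: "'a \<Rightarrow>\<^sub>0 'b::comm_monoid_add"
  assumes "P 0" and "\<And>w c. P (Poly_Mapping.single w c)"
    and "\<And>f g. P f \<Longrightarrow> P g \<Longrightarrow> P (f + g)"
  shows "P f"
proof -
  have "P (\<Sum>w\<in>A. Poly_Mapping.single w (Poly_Mapping.lookup f w))" for A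
    using assms by (induction A rule: infinite_finite_induct) auto
  then show ?thesis using poly_mapping_expand[of f] by metis
qed

definition restrict_words :: "'x set \<Rightarrow> ('x list \<Rightarrow>\<^sub>0 'k::field) \<Rightarrow> ('x list \<Rightarrow>\<^sub>0 'k)" where
  "restrict_words X f =
     (\<Sum>w\<in>Poly_Mapping.keys f \<inter> lists X. Poly_Mapping.single w (Poly_Mapping.lookup f w))"

lemma lookup_restrict_words:
  "Poly_Mapping.lookup (restrict_words X f) w = (if w \<in> lists X then Poly_Mapping.lookup f w else 0)"
proof (cases "w \<in> Poly_Mapping.keys f \<inter> lists X")
  case True
  then show ?thesis
    by (simp add: restrict_words_def lookup_sum lookup_single when_def)
next
  case False
  then show ?thesis
    by (auto simp: restrict_words_def lookup_sum lookup_single when_def in_keys_iff intro!: sum.neutral)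
qed

lemma keys_restrict_words: "Poly_Mapping.keys (restrict_words X f) \<subseteq> lists X"
  by (auto simp: in_keys_iff lookup_restrict_words split: if_splits)

lemma restrict_words_id: "Poly_Mapping.keys f \<subseteq> lists X \<Longrightarrow> restrict_words X f = f"
  by (rule poly_mapping_eqI) (auto simp: lookup_restrict_words in_keys_iff)

lemma restrict_words_add: "restrict_words X (f + g) = restrict_words X f + restrict_words X g"
  by (rule poly_mapping_eqI) (simp add: lookup_restrict_words lookup_add)

lemma restrict_words_zero [simp]: "restrict_words X 0 = 0"
  by (rule poly_mapping_eqI) (simp add: lookup_restrict_words)

lemma restrict_words_single:
  "restrict_words X (Poly_Mapping.single w c) = (if w \<in> lists X then Poly_Mapping.single w c else 0)"
  by (rule poly_mapping_eqI) (auto simp: lookup_restrict_words lookup_single when_def)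

text \<open>A concatenation is a word over \<open>X\<close> exactly when both factors are, so
  discarding all other words is a ring homomorphism.\<close>

lemma restrict_words_mult: "restrict_words X (f * g) = restrict_words X f * restrict_words X g"
proof (induction f rule: poly_mapping_induct)
  case (single u c)
  show ?case
    by (induction g rule: poly_mapping_induct)
      (auto simp: mult_single restrict_words_single plus_list_def restrict_words_add distrib_left)
qed (simp_all add: restrict_words_add distrib_right)

text \<open>The empty word is the unit of the free algebra on the type, so
  \<open>single [] c\<close> is the scalar \<open>c\<close>, and scalars are central.\<close>

lemma single_Nil_commute:
  "x * Poly_Mapping.single [] c = Poly_Mapping.single [] c * (x :: 'x list \<Rightarrow>\<^sub>0 'k::field)"
  by (induction x rule: poly_mapping_induct)
    (simp_all add: mult_single plus_list_def distrib_left distrib_right mult.commute)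

context ultragraph
begin

lemma lpa_ideal_simps:
  fixes x y :: "('v, 'e) lpa_gen list \<Rightarrow>\<^sub>0 'k::field"
  shows "0 \<in> (lpa_ideal \<G> :: (('v, 'e) lpa_gen list \<Rightarrow>\<^sub>0 'k) set)"
    and "x \<in> lpa_ideal \<G> \<Longrightarrow> y \<in> lpa_ideal \<G> \<Longrightarrow> x + y \<in> lpa_ideal \<G>"
    and "x \<in> lpa_ideal \<G> \<Longrightarrow> y \<in> carrier (lpa_free \<G>) \<Longrightarrow> x * y \<in> lpa_ideal \<G>"
    and "x \<in> lpa_ideal \<G> \<Longrightarrow> y \<in> carrier (lpa_free \<G>) \<Longrightarrow> y * x \<in> lpa_ideal \<G>"
    and "x \<in> lpa_ideal \<G> \<Longrightarrow> Poly_Mapping.single [] c * x \<in> lpa_ideal \<G>"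
    and "lpa_ideal \<G> \<subseteq> (carrier (lpa_free \<G>) :: (('v, 'e) lpa_gen list \<Rightarrow>\<^sub>0 'k) set)"
    and "lpa_relators \<G> \<subseteq> (lpa_ideal \<G> :: (('v, 'e) lpa_gen list \<Rightarrow>\<^sub>0 'k) set)"
proof -
  let ?F = "lpa_free \<G> :: ('k, ('v, 'e) lpa_gen list \<Rightarrow>\<^sub>0 'k) module"
  have *: "two_sided_ideal ?F (lpa_ideal \<G>)" by (rule two_sided_ideal_lpa_ideal)
  interpret additive_subgroup "lpa_ideal \<G>" ?F using * by (simp add: two_sided_ideal_def)
  show "0 \<in> (lpa_ideal \<G> :: (('v, 'e) lpa_gen list \<Rightarrow>\<^sub>0 'k) set)"
    using zero_closed by (simp add: lpa_free_def free_algebra_def)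
  show "x \<in> lpa_ideal \<G> \<Longrightarrow> y \<in> lpa_ideal \<G> \<Longrightarrow> x + y \<in> lpa_ideal \<G>"
    using a_closed[of x y] by (simp add: lpa_free_def free_algebra_def)
  show "x \<in> lpa_ideal \<G> \<Longrightarrow> y \<in> carrier (lpa_free \<G>) \<Longrightarrow> x * y \<in> lpa_ideal \<G>"
    and "x \<in> lpa_ideal \<G> \<Longrightarrow> y \<in> carrier (lpa_free \<G>) \<Longrightarrow> y * x \<in> lpa_ideal \<G>"
    using * by (auto simp: two_sided_ideal_def lpa_free_def free_algebra_def)
  show "x \<in> lpa_ideal \<G> \<Longrightarrow> Poly_Mapping.single [] c * x \<in> lpa_ideal \<G>"
    by (auto simp: lpa_ideal_def generated_ideal_def lpa_free_def free_algebra_def)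
  show "lpa_ideal \<G> \<subseteq> carrier ?F" by (rule a_subset)
  show "lpa_relators \<G> \<subseteq> (lpa_ideal \<G> :: (('v, 'e) lpa_gen list \<Rightarrow>\<^sub>0 'k) set)"
    by (auto simp: lpa_ideal_def generated_ideal_def)
qed

lemma carrier_lpa_free:
  "carrier (lpa_free \<G>) = {f. Poly_Mapping.keys f \<subseteq> lists (lpa_gens \<G>) - {[]}}"
  by (simp add: lpa_free_def free_algebra_def)

lemma lists_decomp:
  assumes "Poly_Mapping.keys y \<subseteq> lists (lpa_gens \<G>)"
  obtains z k where "z \<in> carrier (lpa_free \<G>)" "y = z + Poly_Mapping.single [] k"
proof
  let ?k = "Poly_Mapping.lookup y []"
  let ?z = "y - Poly_Mapping.single [] ?k"
  have "Poly_Mapping.lookup ?z [] = 0" by (simp add: lookup_minus)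
  then show "?z \<in> carrier (lpa_free \<G>)"
    using assms by (auto simp: carrier_lpa_free in_keys_iff lookup_minus lookup_single when_def
      split: if_splits)
  show "y = ?z + Poly_Mapping.single [] ?k" by simp
qed

text \<open>The ideal is closed under scalars, so it remains an ideal after a unit is adjoined; the
  constant term of \<open>y\<close> acts as a scalar.\<close>

lemma lpa_ideal_mult_words:
  fixes x y :: "('v, 'e) lpa_gen list \<Rightarrow>\<^sub>0 'k::field"
  assumes x: "x \<in> lpa_ideal \<G>" and y: "Poly_Mapping.keys y \<subseteq> lists (lpa_gens \<G>)"
  shows "x * y \<in> lpa_ideal \<G>" and "y * x \<in> lpa_ideal \<G>"
proof -
  obtain z k where "z \<in> carrier (lpa_free \<G>)" "y = z + Poly_Mapping.single [] k"
    using y by (rule lists_decomp)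
  with x show "x * y \<in> lpa_ideal \<G>" and "y * x \<in> lpa_ideal \<G>"
    by (simp_all add: distrib_left distrib_right lpa_ideal_simps single_Nil_commute[of x k])
qed

text \<open>The preimage of the ideal under the projection that kills the letters which are not
  generators is an ideal of the whole type, so that computations modulo it need no carrier
  conditions; on the carrier it coincides with \<open>lpa_ideal\<close>.\<close>

definition lpa_null :: "(('v, 'e) lpa_gen list \<Rightarrow>\<^sub>0 'k::field) set" where
  "lpa_null = {z. restrict_words (lpa_gens \<G>) z \<in> lpa_ideal \<G>}"

lemma lpa_null_carrier: "x \<in> carrier (lpa_free \<G>) \<Longrightarrow> x \<in> lpa_null \<longleftrightarrow> x \<in> lpa_ideal \<G>"
  by (auto simp: lpa_null_def carrier_lpa_free restrict_words_id subset_iff)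

lemma lpa_null_0 [simp]: "0 \<in> lpa_null"
  by (simp add: lpa_null_def lpa_ideal_simps)

lemma lpa_null_add: "x \<in> lpa_null \<Longrightarrow> y \<in> lpa_null \<Longrightarrow> x + y \<in> lpa_null"
  by (simp add: lpa_null_def lpa_ideal_simps restrict_words_add)

lemma lpa_null_mult:
  assumes "x \<in> lpa_null"
  shows "x * y \<in> lpa_null" and "y * x \<in> lpa_null"
  using assms by (simp_all add: lpa_null_def restrict_words_mult lpa_ideal_mult_words keys_restrict_words)

lemma lpa_null_uminus: "x \<in> lpa_null \<Longrightarrow> - x \<in> lpa_null"
  using lpa_null_mult(1)[of x "-1"] by simp

lemma lpa_null_diff: "x \<in> lpa_null \<Longrightarrow> y \<in> lpa_null \<Longrightarrow> x - y \<in> lpa_null"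
  using lpa_null_add[of x "- y"] lpa_null_uminus[of y] by simp

lemma lpa_null_sum: "(\<And>i. i \<in> A \<Longrightarrow> f i \<in> lpa_null) \<Longrightarrow> sum f A \<in> lpa_null"
  by (induction A rule: infinite_finite_induct) (auto intro: lpa_null_add)

text \<open>The middle factor \<open>a\<close> may have a constant term \<open>k\<close>, which
  contributes \<open>k x y\<close>; this is where the hypothesis on \<open>x * y\<close>
  enters.\<close>

lemma lpa_null_sandwich:
  assumes x: "x \<in> carrier (lpa_free \<G>)" and y: "y \<in> carrier (lpa_free \<G>)"
    and "x * y \<in> lpa_ideal \<G>" and "\<And>a. a \<in> carrier (lpa_free \<G>) \<Longrightarrow> x * a * y \<in> lpa_ideal \<G>"
  shows "x * a * y \<in> lpa_null"
proof -
  obtain z k where z: "z \<in> carrier (lpa_free \<G>)"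
    "restrict_words (lpa_gens \<G>) a = z + Poly_Mapping.single [] k"
    using keys_restrict_words by (rule lists_decomp)
  have "restrict_words (lpa_gens \<G>) x = x" "restrict_words (lpa_gens \<G>) y = y"
    using x y by (auto simp: carrier_lpa_free intro!: restrict_words_id)
  then have "restrict_words (lpa_gens \<G>) (x * a * y) =
      x * z * y + Poly_Mapping.single [] k * (x * y)"
    by (simp add: restrict_words_mult z(2) distrib_left distrib_right mult.assoc
      single_Nil_commute[of x k, unfolded mult.assoc, symmetric])
      (simp add: mult.assoc[symmetric] single_Nil_commute[of x k])
  then show ?thesis using assms(3) assms(4)[OF z(1)] by (simp add: lpa_null_def lpa_ideal_simps)
qed

lemma lpa_null_relators: "lpa_relators \<G> \<subseteq> lpa_null"
  using lpa_null_carrier lpa_relators_subset lpa_ideal_simps(7) by blast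

definition lpa_cong :: "(('v, 'e) lpa_gen list \<Rightarrow>\<^sub>0 'k::field) \<Rightarrow> _ \<Rightarrow> bool"
    (infix "\<approx>\<^sub>L" 50) where
  "x \<approx>\<^sub>L y \<longleftrightarrow> x - y \<in> lpa_null"

lemma lpa_cong_refl [simp]: "x \<approx>\<^sub>L x"
  by (simp add: lpa_cong_def)

lemma lpa_cong_sym: "x \<approx>\<^sub>L y \<Longrightarrow> y \<approx>\<^sub>L x"
  using lpa_null_uminus[of "x - y"] by (simp add: lpa_cong_def)

lemma lpa_cong_trans [trans]: "x \<approx>\<^sub>L y \<Longrightarrow> y \<approx>\<^sub>L z \<Longrightarrow> x \<approx>\<^sub>L z"
  using lpa_null_add[of "x - y" "y - z"] by (simp add: lpa_cong_def)

lemma lpa_cong_add: "x \<approx>\<^sub>L y \<Longrightarrow> x' \<approx>\<^sub>L y' \<Longrightarrow> x + x' \<approx>\<^sub>L y + y'"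
  using lpa_null_add[of "x - y" "x' - y'"] by (simp add: lpa_cong_def algebra_simps)

lemma lpa_cong_diff: "x \<approx>\<^sub>L y \<Longrightarrow> x' \<approx>\<^sub>L y' \<Longrightarrow> x - x' \<approx>\<^sub>L y - y'"
  using lpa_null_diff[of "x - y" "x' - y'"] by (simp add: lpa_cong_def algebra_simps)

lemma lpa_cong_mult: "x \<approx>\<^sub>L y \<Longrightarrow> x' \<approx>\<^sub>L y' \<Longrightarrow> x * x' \<approx>\<^sub>L y * y'"
  using lpa_null_add[OF lpa_null_mult(1)[of "x - y" x'] lpa_null_mult(2)[of "x' - y'" y]]
  by (simp add: lpa_cong_def algebra_simps)

lemma lpa_cong_sum: "(\<And>i. i \<in> A \<Longrightarrow> f i \<approx>\<^sub>L g i) \<Longrightarrow> sum f A \<approx>\<^sub>L sum g A"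
  using lpa_null_sum[of A "\<lambda>i. f i - g i"] by (simp add: lpa_cong_def sum_subtractf)

lemma lpa_null_cong: "x \<approx>\<^sub>L y \<Longrightarrow> x \<in> lpa_null \<longleftrightarrow> y \<in> lpa_null"
  using lpa_null_add[of "x - y" y] lpa_null_diff[of x "x - y"] by (auto simp: lpa_cong_def)

lemma lpa_null_iff_cong: "x \<in> lpa_null \<longleftrightarrow> x \<approx>\<^sub>L 0"
  by (simp add: lpa_cong_def)

section \<open>The defining relations as congruences\<close>

lemma lpa_relator_cong: "x - y \<in> lpa_relators \<G> \<Longrightarrow> x \<approx>\<^sub>L y"
  using lpa_null_relators by (auto simp: lpa_cong_def)

lemma lpa_rel_empty: "pP {} \<approx>\<^sub>L 0"
  by (rule lpa_relator_cong, unfold lpa_relators_def diff_zero) blast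

lemma lpa_rel_inter: "A \<in> gen_verts \<G> \<Longrightarrow> B \<in> gen_verts \<G> \<Longrightarrow> pP A * pP B \<approx>\<^sub>L pP (A \<inter> B)"
  by (rule lpa_relator_cong, unfold lpa_relators_def) blast

lemma lpa_rel_union: "A \<in> gen_verts \<G> \<Longrightarrow> B \<in> gen_verts \<G> \<Longrightarrow>
    pP (A \<union> B) \<approx>\<^sub>L pP A + pP B - pP (A \<inter> B)"
  by (rule lpa_relator_cong, unfold lpa_relators_def) blast

lemma lpa_rel_source_edge: "e \<in> edges \<G> \<Longrightarrow> pP {ug_source \<G> e} * sE e \<approx>\<^sub>L sE e"
  by (rule lpa_relator_cong, unfold lpa_relators_def) blast

lemma lpa_rel_edge_range: "e \<in> edges \<G> \<Longrightarrow> sE e * pP (ug_range \<G> e) \<approx>\<^sub>L sE e"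
  by (rule lpa_relator_cong, unfold lpa_relators_def) blast

lemma lpa_rel_range_ghost: "e \<in> edges \<G> \<Longrightarrow> pP (ug_range \<G> e) * sG e \<approx>\<^sub>L sG e"
  by (rule lpa_relator_cong, unfold lpa_relators_def) blast

lemma lpa_rel_ghost_source: "e \<in> edges \<G> \<Longrightarrow> sG e * pP {ug_source \<G> e} \<approx>\<^sub>L sG e"
  by (rule lpa_relator_cong, unfold lpa_relators_def) blast

lemma lpa_rel_regular: "regular_vertex \<G> v \<Longrightarrow>
    pP {v} \<approx>\<^sub>L (\<Sum>e | e \<in> edges \<G> \<and> ug_source \<G> e = v. sE e * sG e)"
  by (rule lpa_relator_cong, unfold lpa_relators_def) blast

lemma lpa_rel_ghost_edge:
  assumes "e \<in> edges \<G>" "f \<in> edges \<G>"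
  shows "sG e * sE f \<approx>\<^sub>L (if e = f then pP (ug_range \<G> e) else 0)"
  by (rule lpa_relator_cong, unfold lpa_relators_def) (use assms in blast)

end

section \<open>A graded representation\<close>

fun partial_eval :: "('p \<Rightarrow> 'k::zero) \<Rightarrow> 'p option \<Rightarrow> 'k" where
  "partial_eval g None = 0"
| "partial_eval g (Some y) = g y"

lemma partial_eval_simps [simp]:
  "partial_eval (\<lambda>y. 0) p = 0"
  "partial_eval (\<lambda>y. g y + h y) p = partial_eval g p + (partial_eval h p :: 'k::field)"
  "partial_eval (\<lambda>y. c * g y) p = c * (partial_eval g p :: 'k::field)"
  by (cases p; simp)+

context ultragraph
begin

text \<open>The triples are the points, degree aside, that have to be placed over \<open>v\<close>.
  The factor \<open>nat\<close> makes the set infinite as soon as \<open>v\<close> emits an edge, so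
  that \<open>to_nat_on\<close> enumerates it without gaps.\<close>

definition exits :: "'v \<Rightarrow> ('e \<times> 'v \<times> nat) set" where
  "exits v = {(e, w, n). e \<in> edges \<G> \<and> ug_source \<G> e = v \<and> w \<in> ug_range \<G> e}"

text \<open>A point \<open>(v, n, d)\<close> lies over the vertex \<open>v\<close> and has degree \<open>d\<close>. An edge \<open>e\<close> embeds the
  points over its range into the points over its source; these images are disjoint for different
  edges, and they exhaust the points over any vertex that emits edges.\<close>

definition extend :: "'e \<Rightarrow> 'v \<times> nat \<times> int \<Rightarrow> 'v \<times> nat \<times> int" where
  "extend e = (\<lambda>(w, n, d). (ug_source \<G> e, to_nat_on (exits (ug_source \<G> e)) (e, w, n), d + 1))"

text \<open>Words move points from left to right, and composition with functions reverses the order,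
  so that functions form a left module. Hence on points a ghost edge extends and an edge is the
  partial inverse. The membership tests make every letter that is not a generator nowhere defined,
  in accordance with \<open>restrict_words\<close>.\<close>

fun act :: "('v, 'e) lpa_gen \<Rightarrow> 'v \<times> nat \<times> int \<Rightarrow> ('v \<times> nat \<times> int) option" where
  "act (Proj A) x = (if A \<in> gen_verts \<G> \<and> fst x \<in> A then Some x else None)"
| "act (Ghost e) x =
     (if e \<in> edges \<G> \<and> fst x \<in> ug_range \<G> e then Some (extend e x) else None)"
| "act (Edge e) x =
     (if e \<in> edges \<G> \<and> x \<in> extend e ` {y. fst y \<in> ug_range \<G> e}
      then Some (inv_into {y. fst y \<in> ug_range \<G> e} (extend e) x) else None)"

fun act_word :: "('v, 'e) lpa_gen list \<Rightarrow> 'v \<times> nat \<times> int \<Rightarrow> ('v \<times> nat \<times> int) option" where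
  "act_word [] x = Some x"
| "act_word (a # w) x = Option.bind (act a x) (act_word w)"

definition rep ::
  "(('v, 'e) lpa_gen list \<Rightarrow>\<^sub>0 'k::field) \<Rightarrow> ('v \<times> nat \<times> int \<Rightarrow> 'k) \<Rightarrow> 'v \<times> nat \<times> int \<Rightarrow> 'k" where
  "rep f g x =
     (\<Sum>w\<in>Poly_Mapping.keys f. Poly_Mapping.lookup f w * partial_eval g (act_word w x))"

lemma countable_exits: "countable (exits v)"
proof (rule countable_subset)
  show "exits v \<subseteq> edges \<G> \<times> verts \<G> \<times> UNIV"
    using range_subset by (auto simp: exits_def)
  show "countable (edges \<G> \<times> verts \<G> \<times> (UNIV :: nat set))"
    by (intro countable_SIGMA countable_edges countable_verts) auto
qed

text \<open>The source is kept as first coordinate, so equal images use the same enumeration of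
  exits, which is injective on a countable set.\<close>

lemma extend_eq_iff:
  assumes "e \<in> edges \<G>" "fst y \<in> ug_range \<G> e" "f \<in> edges \<G>" "fst z \<in> ug_range \<G> f"
  shows "extend e y = extend f z \<longleftrightarrow> e = f \<and> y = z"
proof
  assume *: "extend e y = extend f z"
  obtain w n d where y: "y = (w, n, d)" by (cases y)
  obtain w' n' d' where z: "z = (w', n', d')" by (cases z)
  have s: "ug_source \<G> f = ug_source \<G> e" and "d = d'"
    and t: "to_nat_on (exits (ug_source \<G> e)) (e, w, n)
      = to_nat_on (exits (ug_source \<G> e)) (f, w', n')"
    using * by (auto simp: y z extend_def)
  moreover have "(e, w, n) = (f, w', n')"
    by (rule inj_onD[OF inj_on_to_nat_on[OF countable_exits] t])
      (use assms s in \<open>auto simp: y z exits_def\<close>)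
  ultimately show "e = f \<and> y = z" by (simp add: y z)
qed simp

text \<open>The range of \<open>f\<close> is nonempty, so the exits contain all
  \<open>(f, w, n)\<close> for some \<open>w\<close> and are infinite; every natural number is then
  the code of an exit. The preimage has degree \<open>d - 1\<close> because an edge raises the
  degree by one.\<close>

lemma extend_surj:
  assumes "f \<in> edges \<G>"
  obtains e y where "e \<in> edges \<G>" "ug_source \<G> e = ug_source \<G> f" "fst y \<in> ug_range \<G> e"
    "(ug_source \<G> f, m, d) = extend e y"
proof -
  obtain w where "w \<in> ug_range \<G> f" using range_nonempty[OF assms] by blast
  then have "range (\<lambda>n. (f, w, n)) \<subseteq> exits (ug_source \<G> f)"
    using assms by (auto simp: exits_def)
  then have "infinite (exits (ug_source \<G> f))"
    by (rule infinite_super) (simp add: range_inj_infinite inj_def)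
  then have "bij_betw (to_nat_on (exits (ug_source \<G> f))) (exits (ug_source \<G> f)) UNIV"
    by (rule to_nat_on_infinite[OF countable_exits])
  then have "m \<in> to_nat_on (exits (ug_source \<G> f)) ` exits (ug_source \<G> f)"
    by (simp add: bij_betw_imp_surj_on)
  then obtain e w n where t: "(e, w, n) \<in> exits (ug_source \<G> f)"
    "m = to_nat_on (exits (ug_source \<G> f)) (e, w, n)"
    by auto
  show ?thesis
    by (rule that[of e "(w, n, d - 1)"]) (use t in \<open>simp_all add: exits_def extend_def\<close>)
qed

lemma act_Ghost_eq_Some:
  "act (Ghost e) x = Some y \<longleftrightarrow> e \<in> edges \<G> \<and> fst x \<in> ug_range \<G> e \<and> y = extend e x"
  by auto

lemma act_Edge_eq_Some:
  "act (Edge e) x = Some y \<longleftrightarrow> e \<in> edges \<G> \<and> fst y \<in> ug_range \<G> e \<and> x = extend e y"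
proof
  let ?D = "{y. fst y \<in> ug_range \<G> e}"
  show "e \<in> edges \<G> \<and> fst y \<in> ug_range \<G> e \<and> x = extend e y" if "act (Edge e) x = Some y"
  proof -
    have e: "e \<in> edges \<G>" and x: "x \<in> extend e ` ?D" and y: "y = inv_into ?D (extend e) x"
      using that by (auto split: if_splits)
    show ?thesis using inv_into_into[OF x] f_inv_into_f[OF x] e y by simp
  qed
  show "act (Edge e) x = Some y" if "e \<in> edges \<G> \<and> fst y \<in> ug_range \<G> e \<and> x = extend e y"
  proof -
    have "inj_on (extend e) ?D"
      using that extend_eq_iff[of e _ e] by (auto intro!: inj_onI)
    then show ?thesis using that by simp
  qed
qed

declare act.simps(2,3) [simp del]

lemma act_Edge_extend:
  assumes "e \<in> edges \<G>" "fst y \<in> ug_range \<G> e" "f \<in> edges \<G>"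
  shows "act (Edge f) (extend e y) = (if e = f then Some y else None)"
proof (cases "e = f")
  case True
  then show ?thesis using assms act_Edge_eq_Some[of e "extend e y" y] by simp
next
  case False
  then have "act (Edge f) (extend e y) \<noteq> Some z" for z
    using assms extend_eq_iff[of e y f z] unfolding act_Edge_eq_Some by blast
  then show ?thesis using False by (cases "act (Edge f) (extend e y)") auto
qed

lemma act_word_append: "act_word (u @ w) x = Option.bind (act_word u x) (act_word w)"
  by (induction u arbitrary: x) (auto split: bind_splits)

lemma rep_superset:
  assumes "finite A" "Poly_Mapping.keys f \<subseteq> A"
  shows "rep f g x = (\<Sum>w\<in>A. Poly_Mapping.lookup f w * partial_eval g (act_word w x))"
  unfolding rep_def using assms by (intro sum.mono_neutral_left) (auto simp: in_keys_iff)

lemma rep_0 [simp]: "rep 0 g x = 0"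
  by (simp add: rep_def)

lemma rep_single: "rep (Poly_Mapping.single w c) g x = c * partial_eval g (act_word w x)"
  by (simp add: rep_def)

lemma rep_add: "rep (f + h) g x = rep f g x + rep h g x"
proof -
  let ?A = "Poly_Mapping.keys f \<union> Poly_Mapping.keys h"
  have "rep k g x = (\<Sum>w\<in>?A. Poly_Mapping.lookup k w * partial_eval g (act_word w x))"
    if "k \<in> {f, h, f + h}" for k
    using that keys_add[of f h] by (intro rep_superset) auto
  then show ?thesis by (simp add: lookup_add distrib_right sum.distrib)
qed

lemma rep_uminus: "rep (- f) g x = - rep f g x"
  using rep_add[of f "- f" g x] by (simp add: add_eq_0_iff)

lemma rep_diff: "rep (f - h) g x = rep f g x - rep h g x"
  using rep_add[of f "- h" g x] by (simp add: rep_uminus)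

lemma rep_sum: "rep (sum f A) g x = (\<Sum>i\<in>A. rep (f i) g x)"
  by (induction A rule: infinite_finite_induct) (auto simp: rep_add)

lemma rep_zero_fun [simp]: "rep f (\<lambda>x. 0) x = 0"
  by (simp add: rep_def)

lemma rep_mult: "rep (f * h) g x = rep f (rep h g) x"
proof (induction f arbitrary: x rule: poly_mapping_induct)
  case (single u c)
  show ?case
  proof (induction h rule: poly_mapping_induct)
    case zero
    have "rep 0 g = (\<lambda>x. 0)" by (simp add: fun_eq_iff)
    then show ?case by simp
  next
    case (single w d)
    show ?case
      by (cases "act_word u x")
        (simp_all add: mult_single plus_list_def rep_single act_word_append)
  next
    case (add h k)
    have "rep (h + k) g = (\<lambda>x. rep h g x + rep k g x)" by (simp add: fun_eq_iff rep_add)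
    with add show ?case by (simp add: distrib_left rep_add rep_single)
  qed
qed (simp_all add: distrib_right rep_add)

lemma rep_gen: "rep (gen a) g x = partial_eval g (act a x)"
  by (cases "act a x") (simp_all add: gen_def rep_single)

text \<open>A point over \<open>v\<close> lies in the image of exactly one edge, by
  \<open>extend_surj\<close> and \<open>extend_eq_iff\<close>. That edge contributes
  \<open>g x\<close> to the sum and all others contribute 0.\<close>

lemma rep_regular_vertex:
  assumes "regular_vertex \<G> v"
  shows "rep (\<Sum>e | e \<in> edges \<G> \<and> ug_source \<G> e = v. sE e * sG e) g x = rep (pP {v}) g x"
proof -
  let ?E = "{e \<in> edges \<G>. ug_source \<G> e = v}"
  have fin: "finite ?E" and v: "{v} \<in> gen_verts \<G>"
    using assms by (auto simp: regular_vertex_def intro: gen_verts.vertex)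
  obtain f where f: "f \<in> edges \<G>" "ug_source \<G> f = v"
    using assms by (auto simp: regular_vertex_def)
  have out: "rep (sE e * sG e) g x = 0" if "\<nexists>y. fst y \<in> ug_range \<G> e \<and> x = extend e y" for e
  proof (cases "act (Edge e) x")
    case (Some y)
    then show ?thesis using that unfolding act_Edge_eq_Some by blast
  qed (simp add: rep_mult rep_gen)
  show ?thesis
  proof (cases "fst x = v")
    case False
    then have "rep (sE e * sG e) g x = 0" if "e \<in> ?E" for e
      using that by (intro out) (auto simp: extend_def split: prod.splits)
    then show ?thesis using False by (simp add: rep_sum rep_gen)
  next
    case True
    obtain m d where x: "x = (v, m, d)" using True by (cases x) auto
    obtain e y where e: "e \<in> edges \<G>" "ug_source \<G> e = v" "fst y \<in> ug_range \<G> e" "x = extend e y"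
      using extend_surj[OF f(1), of m d] unfolding f(2) x by metis
    have "rep (sE e' * sG e') g x = (if e' = e then g x else 0)" if "e' \<in> ?E" for e'
    proof (cases "e' = e")
      case True
      have "act (Edge e) x = Some y" "act (Ghost e) y = Some x"
        using e by (auto simp: act_Edge_eq_Some act_Ghost_eq_Some)
      then show ?thesis using True by (simp add: rep_mult rep_gen)
    next
      case False
      have "\<nexists>z. fst z \<in> ug_range \<G> e' \<and> x = extend e' z"
      proof
        assume "\<exists>z. fst z \<in> ug_range \<G> e' \<and> x = extend e' z"
        then obtain z where "fst z \<in> ug_range \<G> e'" "extend e y = extend e' z"
          using e(4) by metis
        then show False
          using extend_eq_iff[of e y e' z] e(1,3) that False by simp
      qed
      then have "rep (sE e' * sG e') g x = 0" by (rule out)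
      then show ?thesis using False by simp
    qed
    then have "rep (\<Sum>e\<in>?E. sE e * sG e) g x = g x"
      using fin e by (simp add: rep_sum)
    then show ?thesis using True v by (simp add: rep_gen)
  qed
qed

lemma rep_relators:
  assumes "z \<in> lpa_relators \<G>"
  shows "rep z g x = 0"
proof -
  have src: "{ug_source \<G> e} \<in> gen_verts \<G>" if "e \<in> edges \<G>" for e
    using that by (intro gen_verts.vertex source_in_verts)
  have ext: "fst (extend e y) = ug_source \<G> e" for e y
    by (simp add: extend_def split: prod.splits)
  have proj: "rep (pP A * z) g x = (if A \<in> gen_verts \<G> \<and> fst x \<in> A then rep z g x else 0)" for A z
    by (simp add: rep_mult rep_gen)
  have PE: "rep (pP {ug_source \<G> e} * sE e) g x = rep (sE e) g x" if "e \<in> edges \<G>" for e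
  proof (cases "act (Edge e) x")
    case (Some y)
    then have "fst x = ug_source \<G> e" unfolding act_Edge_eq_Some by (simp add: ext)
    then show ?thesis using that by (simp add: proj src)
  qed (simp add: proj rep_gen)
  have EP: "rep (sE e * pP (ug_range \<G> e)) g x = rep (sE e) g x" if "e \<in> edges \<G>" for e
  proof (cases "act (Edge e) x")
    case (Some y)
    then have "fst y \<in> ug_range \<G> e" unfolding act_Edge_eq_Some by simp
    then show ?thesis using that Some by (simp add: rep_mult rep_gen gen_verts.range)
  qed (simp add: rep_mult rep_gen)
  have PG: "rep (pP (ug_range \<G> e) * sG e) g x = rep (sG e) g x" if "e \<in> edges \<G>" for e
    using that by (cases "act (Ghost e) x") (auto simp: proj rep_gen act_Ghost_eq_Some gen_verts.range)
  have GP: "rep (sG e * pP {ug_source \<G> e}) g x = rep (sG e) g x" if "e \<in> edges \<G>" for e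
    using that by (simp add: rep_mult rep_gen act.simps(2) src ext)
  have GE: "rep (sG e * sE f) g x = rep (if e = f then pP (ug_range \<G> e) else 0) g x"
    if "e \<in> edges \<G>" "f \<in> edges \<G>" for e f
    using that by (simp add: rep_mult rep_gen act.simps(2) gen_verts.range act_Edge_extend)
  show ?thesis
    using assms unfolding lpa_relators_def
  proof (elim UnE CollectE exE conjE)
    fix A B assume "A \<in> gen_verts \<G>" "B \<in> gen_verts \<G>"
    note AB = this gen_verts.union[OF this] gen_verts.inter[OF this]
    show "rep z g x = 0" if "z = pP A * pP B - pP (A \<inter> B)"
      unfolding that rep_diff using AB by (simp add: rep_mult rep_gen)
    show "rep z g x = 0" if "z = pP (A \<union> B) - (pP A + pP B - pP (A \<inter> B))"
      unfolding that rep_diff rep_add using AB by (auto simp: rep_gen)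
  next
    fix v assume v: "regular_vertex \<G> v"
    show "rep z g x = 0"
      if "z = pP {v} - (\<Sum>e | e \<in> edges \<G> \<and> ug_source \<G> e = v. sE e * sG e)"
      unfolding that rep_diff rep_regular_vertex[OF v] by simp
  next
    show "rep z g x = 0" if "z \<in> {pP {}}"
      using that by (simp add: rep_gen)
  qed (simp_all only: rep_diff PE EP PG GP GE diff_self)
qed

lemma rep_restrict_words: "rep (restrict_words (lpa_gens \<G>) f) g x = rep f g x"
proof (induction f rule: poly_mapping_induct)
  case (single w c)
  have "act a y = None" if "a \<notin> lpa_gens \<G>" for a y
    using that by (cases a) (auto simp: lpa_gens_def act.simps(2,3))
  then have "act_word w y = None" if "w \<notin> lists (lpa_gens \<G>)" for w y
    using that
  proof (induction w arbitrary: y)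
    case (Cons a w)
    then show ?case by (cases "a \<in> lpa_gens \<G>") (auto split: bind_splits)
  qed simp
  then show ?case by (auto simp: restrict_words_single rep_single)
qed (auto simp: restrict_words_add rep_add)

lemma rep_lpa_ideal:
  fixes z :: "('v, 'e) lpa_gen list \<Rightarrow>\<^sub>0 'k::field"
  assumes "z \<in> lpa_ideal \<G>"
  shows "rep z g x = 0"
proof -
  let ?F = "lpa_free \<G> :: ('k, ('v, 'e) lpa_gen list \<Rightarrow>\<^sub>0 'k) module"
  interpret nonunital_ring ?F by (simp add: lpa_free_def free_algebra_nonunital_ring)
  define K where "K = {z \<in> carrier ?F. \<forall>g x. rep z g x = 0}"
  have zf: "rep z g = (\<lambda>x. 0)" if "z \<in> K" for z g
    using that by (auto simp: K_def)
  have *: "a \<otimes>\<^bsub>?F\<^esub> b = a * b" "a \<oplus>\<^bsub>?F\<^esub> b = a + b" "\<zero>\<^bsub>?F\<^esub> = 0"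
    "c \<odot>\<^bsub>?F\<^esub> b = Poly_Mapping.single [] c * b" for a b c
    by (simp_all add: lpa_free_def free_algebra_def)
  have inv: "\<ominus>\<^bsub>?F\<^esub> a = - a" if "a \<in> carrier ?F" for a
    using that by (intro minus_equality) (auto simp: * carrier_lpa_free)
  have "two_sided_ideal ?F K"
  proof (rule two_sided_idealI)
    fix a y assume "a \<in> K" "y \<in> carrier ?F"
    then show "y \<otimes>\<^bsub>?F\<^esub> a \<in> K" "a \<otimes>\<^bsub>?F\<^esub> y \<in> K"
      using nu_m_closed[of y a] nu_m_closed[of a y] zf[of a] by (auto simp: K_def * rep_mult)
  next
    fix a assume "a \<in> K"
    then show "\<ominus>\<^bsub>?F\<^esub> a \<in> K"
      using a_inv_closed[of a] inv[of a] by (auto simp: K_def rep_uminus)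
  next
    fix a b assume "a \<in> K" "b \<in> K"
    then show "a \<oplus>\<^bsub>?F\<^esub> b \<in> K"
      using a_closed[of a b] by (auto simp: K_def * rep_add)
  qed (use zero_closed in \<open>auto simp: K_def *\<close>)
  moreover have "c \<odot>\<^bsub>?F\<^esub> a \<in> K" if "a \<in> K" for a c
    using that free_algebra_closed(6)[of a "lpa_gens \<G>" c, folded lpa_free_def] zf[OF that]
    by (auto simp: K_def * rep_mult)
  moreover have "lpa_relators \<G> \<subseteq> K"
    using lpa_relators_subset by (auto simp: K_def rep_relators)
  ultimately have "lpa_ideal \<G> \<subseteq> K"
    unfolding lpa_ideal_def generated_ideal_def by blast
  then show ?thesis using assms unfolding K_def by blast
qed

lemma rep_lpa_null: "z \<in> lpa_null \<Longrightarrow> rep z g x = 0"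
  using rep_lpa_ideal rep_restrict_words unfolding lpa_null_def by (metis mem_Collect_eq)

section \<open>Combinations of real paths\<close>

lemma gen_verts_subset: "A \<in> gen_verts \<G> \<Longrightarrow> A \<subseteq> verts \<G>"
  by (induction rule: gen_verts.induct) (use range_subset in auto)

lemma source_gen_verts: "e \<in> edges \<G> \<Longrightarrow> {ug_source \<G> e} \<in> gen_verts \<G>"
  by (intro gen_verts.vertex source_in_verts)

lemma edge_path_Cons:
  "edge_path \<G> (e # \<alpha>) \<longleftrightarrow>
     e \<in> edges \<G> \<and> (\<alpha> = [] \<or> edge_path \<G> \<alpha> \<and> ug_source \<G> (hd \<alpha>) \<in> ug_range \<G> e)"
proof (cases \<alpha>)
  case (Cons f \<beta>)
  show ?thesis
  proof
    assume *: "edge_path \<G> (e # \<alpha>)"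
    have "ug_source \<G> (\<alpha> ! Suc i) \<in> ug_range \<G> (\<alpha> ! i)" if "Suc i < length \<alpha>" for i
      using * that unfolding edge_path_def by (metis Suc_less_eq length_Cons nth_Cons_Suc)
    moreover have "ug_source \<G> f \<in> ug_range \<G> e"
      using * Cons unfolding edge_path_def by force
    ultimately show "e \<in> edges \<G> \<and> (\<alpha> = [] \<or> edge_path \<G> \<alpha> \<and> ug_source \<G> (hd \<alpha>) \<in> ug_range \<G> e)"
      using * Cons by (simp add: edge_path_def)
  next
    assume *: "e \<in> edges \<G> \<and> (\<alpha> = [] \<or> edge_path \<G> \<alpha> \<and> ug_source \<G> (hd \<alpha>) \<in> ug_range \<G> e)"
    have "ug_source \<G> ((e # \<alpha>) ! Suc i) \<in> ug_range \<G> ((e # \<alpha>) ! i)" if "i < length \<alpha>" for i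
      using * that Cons unfolding edge_path_def by (cases i) auto
    then show "edge_path \<G> (e # \<alpha>)"
      using * Cons unfolding edge_path_def by simp
  qed
qed (simp add: edge_path_def)

lemma edge_path_snoc:
  "edge_path \<G> (\<alpha> @ [f]) \<longleftrightarrow>
     f \<in> edges \<G> \<and> (\<alpha> = [] \<or> edge_path \<G> \<alpha> \<and> ug_source \<G> f \<in> ug_range \<G> (last \<alpha>))"
proof (induction \<alpha>)
  case Nil
  then show ?case by (simp add: edge_path_def)
next
  case (Cons e \<alpha>)
  then show ?case by (cases "\<alpha> = []") (auto simp: edge_path_Cons edge_path_def[of \<G> "[]"])
qed

text \<open>The normal form of a term \<open>s\<^sub>\<alpha> p\<^sub>A\<close>: nothing of
  \<open>A\<close> is cut off by the range of \<alpha>, so each vertex \<open>v\<close> in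
  \<open>A\<close> gives a nonzero \<open>s\<^sub>\<alpha> p\<^sub>v\<close>. The empty list stands
  for a path of length 0 and imposes no restriction.\<close>

definition path_to :: "'e list \<Rightarrow> 'v set \<Rightarrow> bool" where
  "path_to \<alpha> A \<longleftrightarrow> \<alpha> = [] \<or> edge_path \<G> \<alpha> \<and> A \<subseteq> ug_range \<G> (last \<alpha>)"

lemma path_to_Cons:
  "path_to (e # \<alpha>) A \<longleftrightarrow> e \<in> edges \<G> \<and> path_to \<alpha> A \<and>
     (if \<alpha> = [] then A else {ug_source \<G> (hd \<alpha>)}) \<subseteq> ug_range \<G> e"
  by (auto simp: path_to_def edge_path_Cons)

lemma path_to_snoc:
  "path_to (\<alpha> @ [f]) A \<longleftrightarrow> f \<in> edges \<G> \<and> path_to \<alpha> {ug_source \<G> f} \<and> A \<subseteq> ug_range \<G> f"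
  by (auto simp: path_to_def edge_path_snoc)

lemma path_to_mono: "path_to \<alpha> A \<Longrightarrow> B \<subseteq> A \<Longrightarrow> path_to \<alpha> B"
  by (auto simp: path_to_def)

text \<open>The list of triples \<open>(k, \<alpha>, A)\<close> stands for the sum of the elements \<open>k s\<^sub>\<alpha> p\<^sub>A\<close>.\<close>

definition comb :: "('k \<times> 'e list \<times> 'v set) list \<Rightarrow> (('v, 'e) lpa_gen list \<Rightarrow>\<^sub>0 'k::field)" where
  "comb l = (\<Sum>(k, \<alpha>, A)\<leftarrow>l. Poly_Mapping.single (map Edge \<alpha>) k * pP A)"

text \<open>Entries with the same path may have overlapping sets, so a list is not determined by its
  sum. Reading \<open>p\<^sub>A\<close> as the indicator function of \<open>A\<close>, the sum is
  described by one step function on vertices for each path; for admissible lists it is zero in the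
  algebra exactly when all these functions vanish.\<close>

definition coef :: "('k::field \<times> 'e list \<times> 'v set) list \<Rightarrow> 'e list \<Rightarrow> 'v \<Rightarrow> 'k" where
  "coef l \<alpha> v = (\<Sum>(k, \<beta>, A)\<leftarrow>l. if \<beta> = \<alpha> \<and> v \<in> A then k else 0)"

definition admissible :: "('k \<times> 'e list \<times> 'v set) list \<Rightarrow> bool" where
  "admissible l \<longleftrightarrow> (\<forall>(k, \<alpha>, A)\<in>set l. A \<in> gen_verts \<G> \<and> path_to \<alpha> A)"

lemma comb_simps [simp]:
  "comb [] = 0"
  "comb ((k, \<alpha>, A) # l) = Poly_Mapping.single (map Edge \<alpha>) k * pP A + comb l"
  "comb (l @ l') = comb l + comb l'"
  by (simp_all add: comb_def)

lemma coef_simps [simp]: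
  "coef [] \<alpha> v = 0"
  "coef ((k, \<beta>, A) # l) \<alpha> v = (if \<beta> = \<alpha> \<and> v \<in> A then k else 0) + coef l \<alpha> v"
  "coef (l @ l') \<alpha> v = coef l \<alpha> v + coef l' \<alpha> v"
  by (simp_all add: coef_def)

lemma admissible_simps [simp]:
  "admissible []"
  "admissible ((k, \<alpha>, A) # l) \<longleftrightarrow> A \<in> gen_verts \<G> \<and> path_to \<alpha> A \<and> admissible l"
  "admissible (l @ l') \<longleftrightarrow> admissible l \<and> admissible l'"
  by (simp_all add: admissible_def ball_Un)

lemma coef_nonzero_path:
  assumes "admissible l" "coef l \<alpha> v \<noteq> 0"
  shows "path_to \<alpha> {v}" and "v \<in> verts \<G>"
proof -
  have "path_to \<alpha> {v} \<and> v \<in> verts \<G>"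
    using assms
  proof (induction l)
    case (Cons a l)
    then show ?case
      using gen_verts_subset by (cases a) (auto split: if_splits intro: path_to_mono)
  qed simp
  then show "path_to \<alpha> {v}" and "v \<in> verts \<G>" by auto
qed

lemma proj_mult_edge:
  assumes "f \<in> edges \<G>" "A \<in> gen_verts \<G>"
  shows "pP A * sE f \<approx>\<^sub>L (if ug_source \<G> f \<in> A then sE f else 0)"
proof -
  have "pP A * sE f \<approx>\<^sub>L pP A * (pP {ug_source \<G> f} * sE f)"
    using assms by (intro lpa_cong_mult lpa_cong_refl lpa_cong_sym[OF lpa_rel_source_edge])
  also have "\<dots> = (pP A * pP {ug_source \<G> f}) * sE f" by (simp add: mult.assoc)
  also have "\<dots> \<approx>\<^sub>L pP (A \<inter> {ug_source \<G> f}) * sE f"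
    using assms by (intro lpa_cong_mult lpa_cong_refl lpa_rel_inter source_gen_verts)
  also have "\<dots> \<approx>\<^sub>L (if ug_source \<G> f \<in> A then sE f else 0)"
  proof (cases "ug_source \<G> f \<in> A")
    case True
    then show ?thesis using lpa_rel_source_edge[OF assms(1)] by simp
  next
    case False
    then show ?thesis
      using lpa_cong_mult[OF lpa_rel_empty lpa_cong_refl[of "sE f"]] by simp
  qed
  finally show ?thesis .
qed

lemma ghost_mult_proj:
  assumes "f \<in> edges \<G>" "A \<in> gen_verts \<G>"
  shows "sG f * pP A \<approx>\<^sub>L (if ug_source \<G> f \<in> A then sG f else 0)"
proof -
  have "sG f * pP A \<approx>\<^sub>L (sG f * pP {ug_source \<G> f}) * pP A"
    using assms by (intro lpa_cong_mult lpa_cong_refl lpa_cong_sym[OF lpa_rel_ghost_source])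
  also have "\<dots> = sG f * (pP {ug_source \<G> f} * pP A)" by (simp add: mult.assoc)
  also have "\<dots> \<approx>\<^sub>L sG f * pP ({ug_source \<G> f} \<inter> A)"
    using assms by (intro lpa_cong_mult lpa_cong_refl lpa_rel_inter source_gen_verts)
  also have "\<dots> \<approx>\<^sub>L (if ug_source \<G> f \<in> A then sG f else 0)"
  proof (cases "ug_source \<G> f \<in> A")
    case True
    then show ?thesis using lpa_rel_ghost_source[OF assms(1)] by simp
  next
    case False
    then show ?thesis
      using lpa_cong_mult[OF lpa_cong_refl[of "sG f"] lpa_rel_empty] by simp
  qed
  finally show ?thesis .
qed

lemma proj_split:
  assumes "A \<in> gen_verts \<G>" "B \<in> gen_verts \<G>"
  shows "pP A \<approx>\<^sub>L pP (A \<inter> B) + pP (A - B)"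
proof -
  have "pP ((A \<inter> B) \<union> (A - B)) \<approx>\<^sub>L pP (A \<inter> B) + pP (A - B) - pP ((A \<inter> B) \<inter> (A - B))"
    using assms by (intro lpa_rel_union gen_verts.intros)
  also have "(A \<inter> B) \<union> (A - B) = A" by blast
  also have "(A \<inter> B) \<inter> (A - B) = {}" by blast
  also have "pP (A \<inter> B) + pP (A - B) - pP {} \<approx>\<^sub>L pP (A \<inter> B) + pP (A - B) - 0"
    by (intro lpa_cong_diff lpa_cong_refl lpa_rel_empty)
  finally show ?thesis by simp
qed

lemma comb_mult_proj:
  assumes "admissible l" "B \<in> gen_verts \<G>"
  shows "comb l * pP B \<approx>\<^sub>L comb (map (\<lambda>(k, \<alpha>, A). (k, \<alpha>, A \<inter> B)) l)"
  using assms(1)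
proof (induction l)
  case (Cons t l)
  obtain k \<alpha> A where t: "t = (k, \<alpha>, A)" by (cases t)
  have "Poly_Mapping.single (map Edge \<alpha>) k * (pP A * pP B) \<approx>\<^sub>L
      Poly_Mapping.single (map Edge \<alpha>) k * pP (A \<inter> B)"
    using Cons.prems assms(2) t by (intro lpa_cong_mult lpa_cong_refl lpa_rel_inter) auto
  then show ?case
    using Cons t by (auto simp: distrib_right mult.assoc intro: lpa_cong_add)
qed simp

text \<open>Generalized vertices are closed under relative complements, so
  \<open>p\<^sub>A (1 - p\<^sub>B)\<close> is again a projection of the algebra, namely that of
  \<open>A - B\<close>.\<close>

lemma comb_minus_proj:
  assumes "admissible l" "B \<in> gen_verts \<G>"
  shows "comb l - comb l * pP B \<approx>\<^sub>L comb (map (\<lambda>(k, \<alpha>, A). (k, \<alpha>, A - B)) l)"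
proof -
  have "comb l \<approx>\<^sub>L comb (map (\<lambda>(k, \<alpha>, A). (k, \<alpha>, A \<inter> B)) l) +
      comb (map (\<lambda>(k, \<alpha>, A). (k, \<alpha>, A - B)) l)"
    using assms(1)
  proof (induction l)
    case (Cons t l)
    obtain k \<alpha> A where t: "t = (k, \<alpha>, A)" by (cases t)
    have "Poly_Mapping.single (map Edge \<alpha>) k * pP A \<approx>\<^sub>L
        Poly_Mapping.single (map Edge \<alpha>) k * (pP (A \<inter> B) + pP (A - B))"
      using Cons.prems assms(2) t by (intro lpa_cong_mult lpa_cong_refl proj_split) auto
    from lpa_cong_add[OF this Cons.IH] show ?case
      using Cons.prems t by (simp add: distrib_left algebra_simps)
  qed simp
  from lpa_cong_diff[OF this comb_mult_proj[OF assms]] show ?thesis by simp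
qed

text \<open>Right multiplication by \<open>s_f\<close>: the product \<open>p\<^sub>A s_f\<close> is
  \<open>s_f\<close>, which carries the projection of its range, if \<open>A\<close> contains the
  source of \<open>f\<close>, and 0 otherwise.\<close>

definition append_edge ::
  "'e \<Rightarrow> ('k \<times> 'e list \<times> 'v set) list \<Rightarrow> ('k \<times> 'e list \<times> 'v set) list" where
  "append_edge f l =
     map (\<lambda>(k, \<alpha>, A). (k, \<alpha> @ [f], ug_range \<G> f)) (filter (\<lambda>(k, \<alpha>, A). ug_source \<G> f \<in> A) l)"

lemma append_edge_simps [simp]:
  "append_edge f [] = []"
  "append_edge f ((k, \<alpha>, A) # l) =
     (if ug_source \<G> f \<in> A then [(k, \<alpha> @ [f], ug_range \<G> f)] else []) @ append_edge f l"
  by (simp_all add: append_edge_def)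

lemma comb_mult_edge:
  assumes "admissible l" "f \<in> edges \<G>"
  shows "comb l * sE f \<approx>\<^sub>L comb (append_edge f l)"
  using assms(1)
proof (induction l)
  case (Cons t l)
  obtain k \<alpha> A where t: "t = (k, \<alpha>, A)" by (cases t)
  have "Poly_Mapping.single (map Edge \<alpha>) k * (pP A * sE f) \<approx>\<^sub>L
      Poly_Mapping.single (map Edge \<alpha>) k * (if ug_source \<G> f \<in> A then sE f else 0)"
    using Cons.prems assms(2) t by (intro lpa_cong_mult lpa_cong_refl proj_mult_edge) auto
  also have "\<dots> \<approx>\<^sub>L Poly_Mapping.single (map Edge \<alpha>) k *
      (if ug_source \<G> f \<in> A then sE f * pP (ug_range \<G> f) else 0)"
    using assms(2) lpa_cong_sym[OF lpa_rel_edge_range]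
    by (intro lpa_cong_mult lpa_cong_refl) auto
  also have "\<dots> = (if ug_source \<G> f \<in> A
      then Poly_Mapping.single (map Edge (\<alpha> @ [f])) k * pP (ug_range \<G> f) else 0)"
    by (simp add: gen_def mult.assoc[symmetric] mult_single plus_list_def)
  finally have "Poly_Mapping.single (map Edge \<alpha>) k * (pP A * sE f) \<approx>\<^sub>L \<dots>" .
  from lpa_cong_add[OF this Cons.IH] Cons.prems t show ?case
    by (cases "ug_source \<G> f \<in> A") (simp_all add: distrib_right mult.assoc)
qed simp

lemma admissible_append_edge: "admissible l \<Longrightarrow> f \<in> edges \<G> \<Longrightarrow> admissible (append_edge f l)"
proof (induction l)
  case (Cons t l)
  then show ?case
    by (cases t) (auto simp: path_to_snoc gen_verts.range intro: path_to_mono)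
qed simp

text \<open>The new coefficient is constant on the range of \<open>f\<close>, so one vertex
  \<open>w\<close> of the range detects the old coefficient at the source.\<close>

lemma coef_append_edge:
  "w \<in> ug_range \<G> f \<Longrightarrow> coef (append_edge f l) (\<alpha> @ [f]) w = coef l \<alpha> (ug_source \<G> f)"
proof (induction l)
  case (Cons t l)
  then show ?case by (cases t) auto
qed simp

lemma admissible_inter:
  "admissible l \<Longrightarrow> B \<in> gen_verts \<G> \<Longrightarrow> admissible (map (\<lambda>(k, \<alpha>, A). (k, \<alpha>, A \<inter> B)) l)"
  by (auto simp: admissible_def intro: gen_verts.inter path_to_mono)

lemma admissible_diff:
  "admissible l \<Longrightarrow> B \<in> gen_verts \<G> \<Longrightarrow> admissible (map (\<lambda>(k, \<alpha>, A). (k, \<alpha>, A - B)) l)"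
  by (auto simp: admissible_def intro: gen_verts.diff path_to_mono)

lemma coef_inter:
  "coef (map (\<lambda>(k, \<alpha>, A). (k, \<alpha>, A \<inter> B)) l) \<alpha> v = (if v \<in> B then coef l \<alpha> v else 0)"
  by (induction l) auto

text \<open>Splitting \<open>B\<close> along the first set of the list makes the remaining sum constant on both
  parts.\<close>

lemma proj_sum_const:
  assumes "\<forall>(k, A)\<in>set ts. A \<in> gen_verts \<G>" "B \<in> gen_verts \<G>"
    and "\<And>v. v \<in> B \<Longrightarrow> (\<Sum>(k, A)\<leftarrow>ts. if v \<in> A then k else 0) = c"
  shows "(\<Sum>(k, A)\<leftarrow>ts. Poly_Mapping.single [] k * pP (A \<inter> B)) \<approx>\<^sub>L Poly_Mapping.single [] c * pP B"
  using assms
proof (induction ts arbitrary: B c)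
  case Nil
  \<comment> \<open>If \<open>B\<close> is empty, \<open>c\<close> is arbitrary and the claim rests
    on \<open>p_{} = 0\<close>; otherwise the hypothesis at a vertex of \<open>B\<close> forces
    \<open>c = 0\<close>.\<close>
  show ?case
  proof (cases "B = {}")
    case True
    then show ?thesis
      using lpa_cong_sym[OF lpa_cong_mult[OF lpa_cong_refl[of "Poly_Mapping.single [] c"] lpa_rel_empty]]
      by simp
  next
    case False
    then show ?thesis using Nil by auto
  qed
next
  case (Cons t ts)
  obtain k A where t: "t = (k, A)" by (cases t)
  have A: "A \<in> gen_verts \<G>" and ts: "\<forall>(k, A)\<in>set ts. A \<in> gen_verts \<G>"
    using Cons.prems(1) t by auto
  let ?s = "\<lambda>x. Poly_Mapping.single [] x :: ('v, 'e) lpa_gen list \<Rightarrow>\<^sub>0 'a"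
  let ?S = "\<lambda>B. (\<Sum>(k, A)\<leftarrow>ts. ?s k * pP (A \<inter> B))"
  have 1: "?S (B \<inter> A) \<approx>\<^sub>L ?s (c - k) * pP (B \<inter> A)"
  proof (intro Cons.IH[OF ts] gen_verts.inter)
    fix v assume "v \<in> B \<inter> A"
    with Cons.prems(3)[of v] t show "(\<Sum>(k, A)\<leftarrow>ts. if v \<in> A then k else 0) = c - k"
      by (simp add: eq_diff_eq add.commute)
  qed (use Cons.prems A in auto)
  have 2: "?S (B - A) \<approx>\<^sub>L ?s c * pP (B - A)"
  proof (intro Cons.IH[OF ts] gen_verts.diff)
    fix v assume "v \<in> B - A"
    with Cons.prems(3)[of v] t show "(\<Sum>(k, A)\<leftarrow>ts. if v \<in> A then k else 0) = c"
      by simp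
  qed (use Cons.prems A in auto)
  have "?S B \<approx>\<^sub>L ?S (B \<inter> A) + ?S (B - A)"
    using ts
  proof (induction ts)
    case (Cons u us)
    obtain j C where u: "u = (j, C)" by (cases u)
    have "pP (C \<inter> B) \<approx>\<^sub>L pP ((C \<inter> B) \<inter> A) + pP ((C \<inter> B) - A)"
      using Cons.prems u \<open>B \<in> gen_verts \<G>\<close> A by (intro proj_split gen_verts.inter) auto
    then have "?s j * pP (C \<inter> B) \<approx>\<^sub>L ?s j * (pP ((C \<inter> B) \<inter> A) + pP ((C \<inter> B) - A))"
      by (intro lpa_cong_mult lpa_cong_refl)
    moreover have "(C \<inter> B) \<inter> A = C \<inter> (B \<inter> A)" "(C \<inter> B) - A = C \<inter> (B - A)" by auto
    ultimately show ?case
      using Cons lpa_cong_add u by (fastforce simp: distrib_left algebra_simps)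
  qed simp
  also have "?S (B \<inter> A) + ?S (B - A) \<approx>\<^sub>L ?s (c - k) * pP (B \<inter> A) + ?s c * pP (B - A)"
    by (rule lpa_cong_add[OF 1 2])
  finally have "?s k * pP (A \<inter> B) + ?S B \<approx>\<^sub>L
      ?s k * pP (A \<inter> B) + (?s (c - k) * pP (B \<inter> A) + ?s c * pP (B - A))"
    by (intro lpa_cong_add lpa_cong_refl)
  also have "\<dots> = ?s c * (pP (B \<inter> A) + pP (B - A))"
    by (simp add: single_diff distrib_left left_diff_distrib Int_commute)
  also have "\<dots> \<approx>\<^sub>L ?s c * pP B"
    using Cons.prems A by (intro lpa_cong_mult lpa_cong_refl lpa_cong_sym[OF proj_split]) auto
  finally show ?case using t by simp
qed

text \<open>All entries with the path \<alpha> of the first entry are split off at once, which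
  shortens the list. Their sum is \<open>s\<^sub>\<alpha>\<close> times a combination of projections
  whose step function is 0 on the union \<open>B\<close> of the sets involved, and
  \<open>proj_sum_const\<close> applies with constant 0.\<close>

lemma comb_null:
  assumes "admissible l" "\<And>\<alpha> v. coef l \<alpha> v = 0"
  shows "comb l \<in> lpa_null"
  using assms
proof (induction l rule: length_induct)
  case (1 l)
  show ?case
  proof (cases l)
    case (Cons t l')
    obtain \<alpha> where \<alpha>: "fst (snd t) = \<alpha>" by blast
    let ?P = "\<lambda>(k, \<beta>, A). \<beta> = \<alpha>"
    let ?l1 = "filter ?P l" and ?l2 = "filter (\<lambda>t. \<not> ?P t) l"
    have comb: "comb l = comb ?l1 + comb ?l2"
      by (induction l) (auto simp: algebra_simps)
    have coef: "coef ?l1 \<beta> v = (if \<beta> = \<alpha> then coef l \<beta> v else 0)"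
      "coef ?l2 \<beta> v = (if \<beta> = \<alpha> then 0 else coef l \<beta> v)" for \<beta> v
      by (induction l) auto
    have "length ?l2 < length l"
      using Cons \<alpha> by (auto simp: less_Suc_eq_le split: prod.splits)
    moreover have "admissible ?l2" "admissible ?l1" using 1(2) by (auto simp: admissible_def)
    ultimately have "comb ?l2 \<in> lpa_null" using 1 coef(2) by simp
    moreover have "comb ?l1 \<in> lpa_null"
    proof -
      let ?ts = "map (\<lambda>(k, \<beta>, A). (k, A)) ?l1"
      define B where "B = \<Union> (snd ` set ?ts)"
      have ts: "\<forall>(k, A)\<in>set ?ts. A \<in> gen_verts \<G>"
        using 1(2) by (auto simp: admissible_def)
      have B: "B \<in> gen_verts \<G>"
      proof -
        have "\<Union> (snd ` set us) \<in> gen_verts \<G>" if "\<forall>(k, A)\<in>set us. A \<in> gen_verts \<G>"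
          for us :: "('a \<times> 'v set) list"
          using that by (induction us) (auto intro: gen_verts.intros)
        then show ?thesis unfolding B_def using ts by blast
      qed
      have AB: "A \<inter> B = A" if "(k, A) \<in> set ?ts" for k A
        using that unfolding B_def by force
      have "(\<Sum>(k, A)\<leftarrow>?ts. if v \<in> A then k else 0) = coef ?l1 \<alpha> v" for v
        by (induction l) auto
      then have "(\<Sum>(k, A)\<leftarrow>?ts. Poly_Mapping.single [] k * pP (A \<inter> B)) \<approx>\<^sub>L
          Poly_Mapping.single [] 0 * pP B"
        using 1(3) coef(1) by (intro proj_sum_const ts B) simp
      also have "(\<Sum>(k, A)\<leftarrow>?ts. Poly_Mapping.single [] k * pP (A \<inter> B)) =
          (\<Sum>(k, A)\<leftarrow>?ts. Poly_Mapping.single [] k * pP A)"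
        by (intro arg_cong[where f = sum_list] map_cong refl) (use AB in \<open>clarify, simp only:\<close>)
      also have "Poly_Mapping.single [] 0 * pP B = 0" by simp
      finally have "Poly_Mapping.single (map Edge \<alpha>) 1 *
          (\<Sum>(k, A)\<leftarrow>?ts. Poly_Mapping.single [] k * pP A) \<in> lpa_null"
        unfolding lpa_null_iff_cong[symmetric] by (rule lpa_null_mult(2))
      moreover have "comb ?l1 =
          Poly_Mapping.single (map Edge \<alpha>) 1 * (\<Sum>(k, A)\<leftarrow>?ts. Poly_Mapping.single [] k * pP A)"
        by (induction l)
          (auto simp: distrib_left mult.assoc[symmetric] mult_single plus_list_def)
      ultimately show ?thesis by (simp only:)
    qed
    ultimately show ?thesis unfolding comb by (rule lpa_null_add[rotated])
  qed simp
qed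

section \<open>Linear independence of the real paths\<close>

lemma act_path_degree:
  "act_word (map Edge \<alpha>) x = Some y \<Longrightarrow> snd (snd x) = snd (snd y) + int (length \<alpha>)"
proof (induction \<alpha> arbitrary: x)
  case (Cons e \<alpha>)
  then obtain z where z: "act (Edge e) x = Some z" "act_word (map Edge \<alpha>) z = Some y"
    by (auto split: bind_splits)
  then have "x = extend e z" by (simp add: act_Edge_eq_Some)
  with Cons.IH[OF z(2)] show ?case by (cases z) (simp add: extend_def)
qed simp

text \<open>A point lies in the image of at most one edge and has one preimage there, so the edges
  that can be stripped from \<open>x\<close> are forced one after the other.\<close>

lemma act_path_unique:
  "act_word (map Edge \<alpha>) x = Some y \<Longrightarrow> act_word (map Edge \<beta>) x = Some z \<Longrightarrow>
     length \<alpha> = length \<beta> \<Longrightarrow> \<alpha> = \<beta>"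
proof (induction \<alpha> arbitrary: x \<beta>)
  case (Cons e \<alpha>)
  obtain f \<gamma> where \<beta>: "\<beta> = f # \<gamma>" using Cons.prems(3) by (cases \<beta>) auto
  obtain p where p: "act (Edge e) x = Some p" "act_word (map Edge \<alpha>) p = Some y"
    using Cons.prems(1) by (auto split: bind_splits)
  obtain q where q: "act (Edge f) x = Some q" "act_word (map Edge \<gamma>) q = Some z"
    using Cons.prems(2) \<beta> by (auto split: bind_splits)
  have "e = f \<and> p = q"
    using p(1) q(1) extend_eq_iff[of e p f q] unfolding act_Edge_eq_Some by metis
  then show ?case using Cons.IH[OF p(2), of \<gamma>] q(2) Cons.prems(3) \<beta> by simp
qed simp

lemma fst_foldr_extend:
  "fst (foldr extend \<alpha> y) = (if \<alpha> = [] then fst y else ug_source \<G> (hd \<alpha>))"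
  by (cases \<alpha>) (auto simp: extend_def split: prod.splits)

lemma act_path_extend:
  "path_to \<alpha> {fst y} \<Longrightarrow> act_word (map Edge \<alpha>) (foldr extend \<alpha> y) = Some y"
proof (induction \<alpha>)
  case (Cons e \<alpha>)
  then have "act (Edge e) (extend e (foldr extend \<alpha> y)) = Some (foldr extend \<alpha> y)"
    by (auto simp: act_Edge_eq_Some path_to_Cons fst_foldr_extend split: if_splits)
  with Cons show ?case by (simp add: path_to_Cons)
qed simp

lemma act_ghost_path:
  "path_to \<alpha> {fst y} \<Longrightarrow> act_word (map Ghost (rev \<alpha>)) y = Some (foldr extend \<alpha> y)"
proof (induction \<alpha>)
  case (Cons e \<alpha>)
  then have "act (Ghost e) (foldr extend \<alpha> y) = Some (extend e (foldr extend \<alpha> y))"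
    by (auto simp: act_Ghost_eq_Some path_to_Cons fst_foldr_extend split: if_splits)
  with Cons show ?case by (simp add: path_to_Cons act_word_append)
qed simp

text \<open>Each projection turns into the test whether the point reached lies over
  \<open>A\<close>, and entries with equal paths merge into \<open>coef\<close>. The index set
  \<Gamma> may exceed the paths of the list, so that a path of interest can always be
  included.\<close>

lemma rep_comb:
  assumes "admissible l" and \<Gamma>: "finite \<Gamma>" "(\<lambda>(k, \<alpha>, A). \<alpha>) ` set l \<subseteq> \<Gamma>"
  shows "rep (comb l) g x =
    (\<Sum>\<gamma>\<in>\<Gamma>. partial_eval (\<lambda>y. coef l \<gamma> (fst y) * g y) (act_word (map Edge \<gamma>) x))"
  using assms(1,3)
proof (induction l)
  case (Cons t l)
  obtain k \<alpha> A where t: "t = (k, \<alpha>, A)" by (cases t)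
  have A: "A \<in> gen_verts \<G>" and \<alpha>: "\<alpha> \<in> \<Gamma>" using Cons.prems t by auto
  have "partial_eval (\<lambda>y. (if \<alpha> = \<gamma> \<and> fst y \<in> A then k else 0) * g y) (act_word (map Edge \<gamma>) x)
      = (if \<gamma> = \<alpha> then rep (Poly_Mapping.single (map Edge \<alpha>) k * pP A) g x else 0)" for \<gamma>
    using A by (cases "act_word (map Edge \<gamma>) x") (auto simp: rep_mult rep_single rep_gen)
  then have "(\<Sum>\<gamma>\<in>\<Gamma>. partial_eval (\<lambda>y. (if \<alpha> = \<gamma> \<and> fst y \<in> A then k else 0) * g y)
      (act_word (map Edge \<gamma>) x)) = rep (Poly_Mapping.single (map Edge \<alpha>) k * pP A) g x"
    using \<Gamma>(1) \<alpha> by simp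
  moreover have "rep (comb l) g x =
      (\<Sum>\<gamma>\<in>\<Gamma>. partial_eval (\<lambda>y. coef l \<gamma> (fst y) * g y) (act_word (map Edge \<gamma>) x))"
    using Cons t by simp
  ultimately show ?case
    using t by (simp add: rep_add distrib_right sum.distrib)
qed simp

lemma degree_foldr_extend:
  "snd (snd (foldr extend \<alpha> y)) = snd (snd y) + int (length \<alpha>)"
  by (induction \<alpha>) (auto simp: extend_def split: prod.splits)

text \<open>Among the paths that act on the point obtained by putting \<alpha> in front of
  \<open>y\<close>, only \<alpha> leads to \<open>y\<close>: the degrees fix the length, and the
  length fixes the path. The indicator function of \<open>y\<close> therefore isolates one
  coefficient.\<close>

lemma rep_comb_extend:
  assumes "admissible l" "path_to \<alpha> {fst y}"
  shows "rep (comb l) (\<lambda>z. if z = y then 1 else 0) (foldr extend \<alpha> y) = coef l \<alpha> (fst y)"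
proof -
  let ?g = "\<lambda>z. if z = y then 1 else 0"
  let ?\<Gamma> = "insert \<alpha> ((\<lambda>(k, \<alpha>, A). \<alpha>) ` set l)"
  have \<alpha>: "act_word (map Edge \<alpha>) (foldr extend \<alpha> y) = Some y"
    using assms(2) by (rule act_path_extend)
  have *: "partial_eval (\<lambda>z. coef l \<gamma> (fst z) * ?g z) (act_word (map Edge \<gamma>) (foldr extend \<alpha> y))
      = (if \<gamma> = \<alpha> then coef l \<alpha> (fst y) else 0)" for \<gamma>
  proof (cases "act_word (map Edge \<gamma>) (foldr extend \<alpha> y) = Some y")
    case True
    then have "length \<gamma> = length \<alpha>"
      using act_path_degree[OF True] act_path_degree[OF \<alpha>] by simp
    then have "\<gamma> = \<alpha>" using True \<alpha> act_path_unique by blast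
    then show ?thesis using True by simp
  next
    case False
    then have "\<gamma> \<noteq> \<alpha>" using \<alpha> by auto
    then show ?thesis
      using False by (cases "act_word (map Edge \<gamma>) (foldr extend \<alpha> y)") auto
  qed
  have \<Gamma>: "finite ?\<Gamma>" "(\<lambda>(k, \<alpha>, A). \<alpha>) ` set l \<subseteq> ?\<Gamma>" by (simp, rule subset_insertI)
  have "rep (comb l) ?g (foldr extend \<alpha> y) = (\<Sum>\<gamma>\<in>?\<Gamma>. if \<gamma> = \<alpha> then coef l \<alpha> (fst y) else 0)"
    by (simp only: rep_comb[OF assms(1) \<Gamma>] *)
  also have "\<dots> = coef l \<alpha> (fst y)" using \<Gamma>(1) by simp
  finally show ?thesis .
qed

lemma coef_eq_0_if_comb_null:
  assumes "admissible l" "comb l \<in> lpa_null"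
  shows "coef l \<alpha> v = 0"
proof (rule ccontr)
  assume nz: "coef l \<alpha> v \<noteq> 0"
  then have "path_to \<alpha> {fst (v, 0 :: nat, 0 :: int)}"
    using coef_nonzero_path(1)[OF assms(1)] by simp
  from rep_comb_extend[OF assms(1) this] nz rep_lpa_null[OF assms(2)] show False by simp
qed

section \<open>The span of the algebra\<close>

definition real_span :: "(('v, 'e) lpa_gen list \<Rightarrow>\<^sub>0 'k::field) set" where
  "real_span = {x. \<exists>l. admissible l \<and> x \<approx>\<^sub>L comb l}"

text \<open>Spans, modulo the relations, of the elements \<open>s\<^sub>\<alpha> p\<^sub>A s\<^sub>\<beta>\<^sup>*\<close> where \<open>\<beta>\<close> has length at most \<open>n\<close>.\<close>

primrec level :: "nat \<Rightarrow> (('v, 'e) lpa_gen list \<Rightarrow>\<^sub>0 'k::field) set" where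
  "level 0 = real_span"
| "level (Suc n) = {x. \<exists>x0\<in>real_span. \<exists>E Y. finite E \<and> E \<subseteq> edges \<G> \<and> (\<forall>e\<in>E. Y e \<in> level n) \<and>
     x \<approx>\<^sub>L x0 + (\<Sum>e\<in>E. Y e * sG e)}"

lemma real_span_cong: "x \<approx>\<^sub>L y \<Longrightarrow> y \<in> real_span \<Longrightarrow> x \<in> real_span"
  unfolding real_span_def using lpa_cong_trans by blast

lemma real_span_comb: "admissible l \<Longrightarrow> comb l \<in> real_span"
  unfolding real_span_def using lpa_cong_refl by blast

lemma real_span_0: "0 \<in> real_span"
  using real_span_comb[of "[]"] by simp

lemma real_span_add:
  assumes "x \<in> real_span" "y \<in> real_span"
  shows "x + y \<in> real_span"
proof -
  obtain l l' where "admissible l" "x \<approx>\<^sub>L comb l" "admissible l'" "y \<approx>\<^sub>L comb l'"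
    using assms by (auto simp: real_span_def)
  then have "admissible (l @ l')" "x + y \<approx>\<^sub>L comb (l @ l')" by (auto intro: lpa_cong_add)
  then show ?thesis unfolding real_span_def by blast
qed

lemma real_span_proj:
  assumes "x \<in> real_span" "B \<in> gen_verts \<G>"
  shows "x * pP B \<in> real_span"
proof -
  obtain l where l: "admissible l" "x \<approx>\<^sub>L comb l" using assms by (auto simp: real_span_def)
  have "x * pP B \<approx>\<^sub>L comb l * pP B" using l by (intro lpa_cong_mult lpa_cong_refl)
  also note comb_mult_proj[OF l(1) assms(2)]
  finally show ?thesis by (rule real_span_cong) (intro real_span_comb admissible_inter l assms)
qed

lemma real_span_edge:
  assumes "x \<in> real_span" "f \<in> edges \<G>"
  shows "x * sE f \<in> real_span"
proof -
  obtain l where l: "admissible l" "x \<approx>\<^sub>L comb l" using assms by (auto simp: real_span_def)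
  have "x * sE f \<approx>\<^sub>L comb l * sE f" using l by (intro lpa_cong_mult lpa_cong_refl)
  also note comb_mult_edge[OF l(1) assms(2)]
  finally show ?thesis by (rule real_span_cong) (intro real_span_comb admissible_append_edge l assms)
qed

lemma level_SucI:
  assumes "x \<approx>\<^sub>L x0 + (\<Sum>e\<in>E. Y e * sG e)" "x0 \<in> real_span" "finite E" "E \<subseteq> edges \<G>"
    and "\<And>e. e \<in> E \<Longrightarrow> Y e \<in> level n"
  shows "x \<in> level (Suc n)"
  unfolding level.simps mem_Collect_eq
  by (intro bexI[of _ x0] exI[of _ E] exI[of _ Y] conjI ballI) (use assms in auto)

lemma level_SucE:
  assumes "x \<in> level (Suc n)"
  obtains x0 E Y where "x0 \<in> real_span" "finite E" "E \<subseteq> edges \<G>" "\<forall>e\<in>E. Y e \<in> level n"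
    "x \<approx>\<^sub>L x0 + (\<Sum>e\<in>E. Y e * sG e)"
  using assms unfolding level.simps mem_Collect_eq
proof (elim bexE exE conjE)
  fix x0 E Y
  assume "x0 \<in> real_span" "finite E" "E \<subseteq> edges \<G>" "\<forall>e\<in>E. Y e \<in> level n"
    "x \<approx>\<^sub>L x0 + (\<Sum>e\<in>E. Y e * sG e)"
  then show thesis by (intro that[of x0 E Y]) simp_all
qed

lemma level_cong: "x \<approx>\<^sub>L y \<Longrightarrow> y \<in> level n \<Longrightarrow> x \<in> level n"
  by (cases n) (auto intro: real_span_cong lpa_cong_trans)

lemma real_span_level: "real_span \<subseteq> level n"
proof (cases n)
  case (Suc m)
  have "x \<in> level (Suc m)" if "x \<in> real_span" for x :: "('v, 'e) lpa_gen list \<Rightarrow>\<^sub>0 'a"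
    by (rule level_SucI[of _ x _ "{}"]) (use that in auto)
  then show ?thesis using Suc by blast
qed simp

lemma level_0: "0 \<in> level n"
  using real_span_level real_span_0 by blast

lemma level_add: "x \<in> level n \<Longrightarrow> y \<in> level n \<Longrightarrow> x + y \<in> level n"
proof (induction n arbitrary: x y)
  case 0
  then show ?case by (simp add: real_span_add)
next
  case (Suc n)
  obtain x0 E Y where x: "x0 \<in> real_span" "finite E" "E \<subseteq> edges \<G>" "\<forall>e\<in>E. Y e \<in> level n"
    "x \<approx>\<^sub>L x0 + (\<Sum>e\<in>E. Y e * sG e)" using Suc.prems(1) by (rule level_SucE)
  obtain y0 F Z where y: "y0 \<in> real_span" "finite F" "F \<subseteq> edges \<G>" "\<forall>e\<in>F. Z e \<in> level n"
    "y \<approx>\<^sub>L y0 + (\<Sum>e\<in>F. Z e * sG e)" using Suc.prems(2) by (rule level_SucE)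
  let ?W = "\<lambda>e. (if e \<in> E then Y e else 0) + (if e \<in> F then Z e else 0)"
  have "(\<Sum>e\<in>E. Y e * sG e) = (\<Sum>e\<in>E \<union> F. (if e \<in> E then Y e else 0) * sG e)"
    "(\<Sum>e\<in>F. Z e * sG e) = (\<Sum>e\<in>E \<union> F. (if e \<in> F then Z e else 0) * sG e)"
    using x(2) y(2) by (auto intro!: sum.mono_neutral_cong_left)
  then have "x + y \<approx>\<^sub>L (x0 + y0) + (\<Sum>e\<in>E \<union> F. ?W e * sG e)"
    using lpa_cong_add[OF x(5) y(5)] by (simp add: distrib_right sum.distrib algebra_simps)
  then show ?case
    by (rule level_SucI)
      (use x(1-4) y(1-4) in \<open>auto intro!: real_span_add Suc.IH level_0\<close>)
qed

lemma level_decomp_proj: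
  assumes "E \<subseteq> edges \<G>" "x \<approx>\<^sub>L x0 + (\<Sum>e\<in>E. Y e * sG e)" "B \<in> gen_verts \<G>"
  shows "x * pP B \<approx>\<^sub>L x0 * pP B + (\<Sum>e\<in>E. (if ug_source \<G> e \<in> B then Y e else 0) * sG e)"
proof -
  have "x * pP B \<approx>\<^sub>L (x0 + (\<Sum>e\<in>E. Y e * sG e)) * pP B"
    using assms(2) by (intro lpa_cong_mult lpa_cong_refl)
  also have "\<dots> = x0 * pP B + (\<Sum>e\<in>E. Y e * (sG e * pP B))"
    by (simp add: distrib_right sum_distrib_right mult.assoc)
  also have "\<dots> \<approx>\<^sub>L x0 * pP B + (\<Sum>e\<in>E. Y e * (if ug_source \<G> e \<in> B then sG e else 0))"
    using assms by (intro lpa_cong_add lpa_cong_sum lpa_cong_mult lpa_cong_refl ghost_mult_proj) auto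
  also have "(\<Sum>e\<in>E. Y e * (if ug_source \<G> e \<in> B then sG e else 0)) =
      (\<Sum>e\<in>E. (if ug_source \<G> e \<in> B then Y e else 0) * sG e)"
    by (rule sum.cong) auto
  finally show ?thesis .
qed

text \<open>Since \<open>s_e\<^sup>* s_f\<close> is 0 unless \<open>e = f\<close>, an edge on the
  right strips one ghost from a single summand and makes the others vanish. This lowers the level
  and drives the later induction.\<close>

lemma level_decomp_edge:
  assumes "finite E" "E \<subseteq> edges \<G>" "x \<approx>\<^sub>L x0 + (\<Sum>e\<in>E. Y e * sG e)" "f \<in> edges \<G>"
  shows "x * sE f \<approx>\<^sub>L x0 * sE f + (if f \<in> E then Y f * pP (ug_range \<G> f) else 0)"
proof -
  have "x * sE f \<approx>\<^sub>L (x0 + (\<Sum>e\<in>E. Y e * sG e)) * sE f"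
    using assms by (intro lpa_cong_mult lpa_cong_refl)
  also have "\<dots> = x0 * sE f + (\<Sum>e\<in>E. Y e * (sG e * sE f))"
    by (simp add: distrib_right sum_distrib_right mult.assoc)
  also have "\<dots> \<approx>\<^sub>L x0 * sE f + (\<Sum>e\<in>E. Y e * (if e = f then pP (ug_range \<G> e) else 0))"
    using assms by (intro lpa_cong_add lpa_cong_sum lpa_cong_mult lpa_cong_refl lpa_rel_ghost_edge) auto
  also have "(\<Sum>e\<in>E. Y e * (if e = f then pP (ug_range \<G> e) else 0)) =
      (\<Sum>e\<in>E. if e = f then Y f * pP (ug_range \<G> f) else 0)"
    by (rule sum.cong) auto
  also have "\<dots> = (if f \<in> E then Y f * pP (ug_range \<G> f) else 0)"
    using assms(1) by simp
  finally show ?thesis .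
qed

lemma level_proj: "x \<in> level n \<Longrightarrow> B \<in> gen_verts \<G> \<Longrightarrow> x * pP B \<in> level n"
proof (cases n)
  case (Suc m)
  assume xn: "x \<in> level n" and B: "B \<in> gen_verts \<G>"
  obtain x0 E Y where x: "x0 \<in> real_span" "finite E" "E \<subseteq> edges \<G>" "\<forall>e\<in>E. Y e \<in> level m"
    "x \<approx>\<^sub>L x0 + (\<Sum>e\<in>E. Y e * sG e)" using xn[unfolded Suc] by (rule level_SucE)
  show ?thesis
    unfolding Suc by (rule level_SucI[OF level_decomp_proj[OF x(3,5) B] real_span_proj[OF x(1) B] x(2,3)])
      (use x(4) level_0 in auto)
qed (simp add: real_span_proj)

lemma level_Suc_edge:
  assumes "x \<in> level (Suc n)" "f \<in> edges \<G>"
  shows "x * sE f \<in> level n"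
proof -
  obtain x0 E Y where x: "x0 \<in> real_span" "finite E" "E \<subseteq> edges \<G>" "\<forall>e\<in>E. Y e \<in> level n"
    "x \<approx>\<^sub>L x0 + (\<Sum>e\<in>E. Y e * sG e)" using assms(1) by (rule level_SucE)
  have "x0 * sE f + (if f \<in> E then Y f * pP (ug_range \<G> f) else 0) \<in> level n"
    using x(4) assms(2) subsetD[OF real_span_level real_span_edge[OF x(1) assms(2)]]
    by (intro level_add) (auto intro: level_0 level_proj gen_verts.range)
  then show ?thesis using level_decomp_edge[OF x(2,3,5) assms(2)] level_cong by blast
qed

lemma level_ghost: "x \<in> level n \<Longrightarrow> e \<in> edges \<G> \<Longrightarrow> x * sG e \<in> level (Suc n)"
  by (rule level_SucI[of _ 0 "\<lambda>_. x" "{e}"]) (auto simp: real_span_0)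

lemma level_Suc_mono: "x \<in> level n \<Longrightarrow> x \<in> level (Suc n)"
proof (induction n arbitrary: x)
  case 0
  then show ?case using real_span_level[of "Suc 0"] by auto
next
  case (Suc n)
  obtain x0 E Y where x: "x0 \<in> real_span" "finite E" "E \<subseteq> edges \<G>" "\<forall>e\<in>E. Y e \<in> level n"
    "x \<approx>\<^sub>L x0 + (\<Sum>e\<in>E. Y e * sG e)" using Suc.prems by (rule level_SucE)
  show ?case
    using x(4) Suc.IH by (intro level_SucI[OF x(5,1,2,3)]) blast
qed

lemma level_mono: "n \<le> m \<Longrightarrow> x \<in> level n \<Longrightarrow> x \<in> level m"
  by (induction rule: dec_induct) (simp_all add: level_Suc_mono del: level.simps)

lemma level_edge: "x \<in> level n \<Longrightarrow> f \<in> edges \<G> \<Longrightarrow> x * sE f \<in> level n"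
  by (intro level_Suc_edge level_Suc_mono)

text \<open>Words are built up on the right, where each further letter raises the level by at most
  one.\<close>

lemma carrier_level:
  assumes "x \<in> carrier (lpa_free \<G>)"
  shows "\<exists>n. x \<in> level n"
proof -
  have word: "\<exists>n. Poly_Mapping.single w k \<in> level n"
    if "w \<in> lists (lpa_gens \<G>)" "w \<noteq> []" for w and k :: 'a
    using that
  proof (induction w rule: rev_induct)
    case (snoc a w)
    have a: "a \<in> lpa_gens \<G>" using snoc.prems by simp
    have mult: "Poly_Mapping.single (w @ [a]) k = Poly_Mapping.single w k * gen a"
      by (simp add: gen_def mult_single plus_list_def)
    show ?case
    proof (cases "w = []")
      case True
      have P: "Poly_Mapping.single [] k * pP A \<in> level n" if "A \<in> gen_verts \<G>" for A n
        using real_span_comb[of "[(k, [], A)]"] real_span_level that by (auto simp: path_to_def)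
      from a consider e where "e \<in> edges \<G>" "a = Edge e" | e where "e \<in> edges \<G>" "a = Ghost e"
        | A where "A \<in> gen_verts \<G>" "a = Proj A"
        by (auto simp: lpa_gens_def)
      then show ?thesis
      proof cases
        case 1
        \<comment> \<open>A scalar alone is not in the span, so the first letter of a word needs a
          projection inserted in front of it: that of the source for an edge, that of the range for
          a ghost.\<close>
        have "Poly_Mapping.single [] k * sE e \<approx>\<^sub>L
            (Poly_Mapping.single [] k * pP {ug_source \<G> e}) * sE e"
          unfolding mult.assoc using 1 by (intro lpa_cong_mult lpa_cong_refl lpa_cong_sym[OF lpa_rel_source_edge])
        moreover have "(Poly_Mapping.single [] k * pP {ug_source \<G> e}) * sE e \<in> level 0"
          using 1 by (intro level_edge P source_gen_verts)
        ultimately show ?thesis using level_cong 1 True mult by metis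
      next
        case 2
        have "Poly_Mapping.single [] k * sG e \<approx>\<^sub>L
            (Poly_Mapping.single [] k * pP (ug_range \<G> e)) * sG e"
          unfolding mult.assoc using 2 by (intro lpa_cong_mult lpa_cong_refl lpa_cong_sym[OF lpa_rel_range_ghost])
        moreover have "(Poly_Mapping.single [] k * pP (ug_range \<G> e)) * sG e \<in> level (Suc 0)"
          using 2 by (intro level_ghost P gen_verts.range)
        ultimately show ?thesis using level_cong 2 True mult by metis
      next
        case 3
        then show ?thesis using P True mult by auto
      qed
    next
      case False
      then obtain n where "Poly_Mapping.single w k \<in> level n" using snoc by auto
      then have "Poly_Mapping.single w k * gen a \<in> level (Suc n)"
        using a
        by (auto simp: lpa_gens_def simp del: level.simps intro: level_edge level_ghost level_proj level_Suc_mono)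
      then show ?thesis using mult by metis
    qed
  qed simp
  have "\<exists>n. (\<Sum>w\<in>W. Poly_Mapping.single w (Poly_Mapping.lookup x w)) \<in> level n"
    if "finite W" "W \<subseteq> lists (lpa_gens \<G>) - {[]}" for W
    using that
  proof (induction W rule: finite_induct)
    case empty
    show ?case using level_0 by auto
  next
    case (insert w W)
    obtain n where "(\<Sum>w\<in>W. Poly_Mapping.single w (Poly_Mapping.lookup x w)) \<in> level n"
      using insert.IH insert.prems by blast
    moreover obtain m where "Poly_Mapping.single w (Poly_Mapping.lookup x w) \<in> level m"
      using word[of w] insert.prems by blast
    ultimately have "Poly_Mapping.single w (Poly_Mapping.lookup x w) +
        (\<Sum>w\<in>W. Poly_Mapping.single w (Poly_Mapping.lookup x w)) \<in> level (max m n)"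
      by (intro level_add) (auto intro: level_mono[of m "max m n"] level_mono[of n "max m n"])
    then show ?case using insert by auto
  qed
  from this[OF finite_keys, of x] show ?thesis
    using assms by (simp add: carrier_lpa_free flip: poly_mapping_expand)
qed

section \<open>Primeness\<close>

lemma finite_gen_verts: "finite V \<Longrightarrow> V \<subseteq> verts \<G> \<Longrightarrow> V \<in> gen_verts \<G>"
proof (induction V rule: finite_induct)
  case (insert v V)
  then have "{v} \<union> V \<in> gen_verts \<G>" by (intro gen_verts.union gen_verts.vertex) auto
  then show ?case by simp
qed (rule gen_verts.empty)

lemma mult_finite_proj_null:
  assumes "finite V" "V \<subseteq> verts \<G>" "\<And>v. v \<in> V \<Longrightarrow> x * pP {v} \<in> lpa_null"
  shows "x * pP V \<in> lpa_null"
  using assms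
proof (induction V rule: finite_induct)
  case empty
  show ?case
    using lpa_rel_empty lpa_null_mult(2) unfolding lpa_null_iff_cong[symmetric] by blast
next
  case (insert v V)
  have "pP ({v} \<union> V) \<approx>\<^sub>L pP {v} + pP V - pP ({v} \<inter> V)"
    using insert.hyps insert.prems(1)
    by (intro lpa_rel_union gen_verts.vertex finite_gen_verts) auto
  also have "{v} \<inter> V = {}" using insert.hyps by simp
  also have "pP {v} + pP V - pP {} \<approx>\<^sub>L pP {v} + pP V - 0"
    by (intro lpa_cong_diff lpa_cong_refl lpa_rel_empty)
  finally have "x * pP ({v} \<union> V) \<approx>\<^sub>L x * (pP {v} + pP V - 0)"
    by (intro lpa_cong_mult lpa_cong_refl)
  moreover have "x * (pP {v} + pP V - 0) \<in> lpa_null"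
    using insert by (simp add: distrib_left lpa_null_add)
  ultimately show ?case by (simp add: lpa_null_cong)
qed

text \<open>An element all of whose right multiples lying in the span of the \<open>s\<^sub>\<alpha> p\<^sub>A\<close> vanish is zero.
  By induction \<open>x s\<^sub>f = 0\<close> for every edge \<open>f\<close>; this gives \<open>x p\<^sub>v = 0\<close> for every vertex \<open>v\<close>, through
  relation (4) if \<open>v\<close> is regular, and otherwise by comparing \<open>x p\<^sub>v\<close> with its real part, which is
  detected on an edge that does not occur in \<open>x\<close>. Removing finitely many vertices from \<open>x\<close> leaves
  only a real part.\<close>

lemma lpa_null_if_real_multiples_null:
  assumes "x \<in> level n" "\<And>b l. admissible l \<Longrightarrow> x * b \<approx>\<^sub>L comb l \<Longrightarrow> comb l \<in> lpa_null"
  shows "x \<in> lpa_null"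
  using assms
proof (induction n arbitrary: x)
  case 0
  then obtain l where l: "admissible l" "x \<approx>\<^sub>L comb l" by (auto simp: real_span_def)
  then have "comb l \<in> lpa_null" using 0(2)[of l 1] by simp
  then show ?case using lpa_null_cong[OF l(2)] by simp
next
  case (Suc n)
  obtain x0 E Y where x0: "x0 \<in> real_span" and E: "finite E" "E \<subseteq> edges \<G>"
    and "\<forall>e\<in>E. Y e \<in> level n"
    and x: "x \<approx>\<^sub>L x0 + (\<Sum>e\<in>E. Y e * sG e)" using Suc.prems(1) by (rule level_SucE)
  obtain l where l: "admissible l" "x0 \<approx>\<^sub>L comb l" using x0 by (auto simp: real_span_def)
  have edge: "x * sE f \<in> lpa_null" if f: "f \<in> edges \<G>" for f
  proof (rule Suc.IH)
    show "x * sE f \<in> level n" using Suc.prems(1) f by (rule level_Suc_edge)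
    show "comb l \<in> lpa_null" if "admissible l" "x * sE f * b \<approx>\<^sub>L comb l" for b l
      using Suc.prems(2)[of l "sE f * b"] that by (simp add: mult.assoc)
  qed
  have vertex: "x * pP {v} \<in> lpa_null" if v: "v \<in> verts \<G>" for v
  proof -
    let ?l = "map (\<lambda>(k, \<alpha>, A). (k, \<alpha>, A \<inter> {v})) l"
    have vg: "{v} \<in> gen_verts \<G>" using v by (rule gen_verts.vertex)
    have adm: "admissible ?l" using l(1) vg by (rule admissible_inter)
    have "x0 * pP {v} \<approx>\<^sub>L comb l * pP {v}" using l by (intro lpa_cong_mult lpa_cong_refl)
    also have "\<dots> \<approx>\<^sub>L comb ?l" using l(1) vg by (rule comb_mult_proj)
    finally have x0v: "x0 * pP {v} \<approx>\<^sub>L comb ?l" .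
    have xv: "x * pP {v} \<approx>\<^sub>L x0 * pP {v} + (\<Sum>e\<in>E. (if ug_source \<G> e \<in> {v} then Y e else 0) * sG e)"
      using E(2) x vg by (rule level_decomp_proj)
    consider "regular_vertex \<G> v" | "{e \<in> edges \<G>. ug_source \<G> e = v} = {}"
      | "infinite {e \<in> edges \<G>. ug_source \<G> e = v}"
      using v by (auto simp: regular_vertex_def)
    then show ?thesis
    proof cases
      case 1
      have "x * pP {v} \<approx>\<^sub>L x * (\<Sum>e | e \<in> edges \<G> \<and> ug_source \<G> e = v. sE e * sG e)"
        using 1 by (intro lpa_cong_mult lpa_cong_refl lpa_rel_regular)
      also have "\<dots> = (\<Sum>e | e \<in> edges \<G> \<and> ug_source \<G> e = v. x * sE e * sG e)"
        by (simp add: sum_distrib_left mult.assoc)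
      finally show ?thesis
        using lpa_null_sum[of "{e \<in> edges \<G>. ug_source \<G> e = v}" "\<lambda>e. x * sE e * sG e"]
          edge lpa_null_mult(1) lpa_null_cong by blast
    next
      case 2
      then have "(\<Sum>e\<in>E. (if ug_source \<G> e \<in> {v} then Y e else 0) * sG e) = 0"
        using E(2) by (intro sum.neutral) auto
      with xv x0v have xl: "x * pP {v} \<approx>\<^sub>L comb ?l" by (simp add: lpa_cong_trans)
      then have "comb ?l \<in> lpa_null" using Suc.prems(2)[OF adm] by blast
      then show ?thesis using lpa_null_cong[OF xl] by simp
    next
      case 3
      then have "infinite ({e \<in> edges \<G>. ug_source \<G> e = v} - E)" using E(1) by simp
      then obtain f where "f \<in> {e \<in> edges \<G>. ug_source \<G> e = v} - E"
        using infinite_imp_nonempty by blast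
      then have f: "f \<in> edges \<G>" "ug_source \<G> f = v" "f \<notin> E" by auto
      have "x * sE f \<approx>\<^sub>L x0 * sE f" using level_decomp_edge[OF E x f(1)] f(3) by simp
      also have "\<dots> \<approx>\<^sub>L comb l * sE f" using l by (intro lpa_cong_mult lpa_cong_refl)
      also have "\<dots> \<approx>\<^sub>L comb (append_edge f l)" using l(1) f(1) by (rule comb_mult_edge)
      finally have null: "comb (append_edge f l) \<in> lpa_null"
        using edge[OF f(1)] lpa_null_cong by blast
      obtain w where w: "w \<in> ug_range \<G> f" using range_nonempty[OF f(1)] by blast
      \<comment> \<open>As \<open>f\<close> is not in \<open>E\<close>, the product
        \<open>x s_f\<close> equals \<open>x0 s_f\<close>, which is known to vanish; its
        coefficients along \<alpha> followed by \<open>f\<close> are those of \<open>x0\<close> at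
        \<open>v\<close>.\<close>
      have "coef l \<alpha> v = 0" for \<alpha>
        using coef_eq_0_if_comb_null[OF admissible_append_edge[OF l(1) f(1)] null]
          coef_append_edge[OF w, of l \<alpha>] f(2) by simp
      then have "comb ?l \<in> lpa_null"
        by (intro comb_null adm) (simp add: coef_inter)
      then have x0v_null: "x0 * pP {v} \<in> lpa_null" using lpa_null_cong[OF x0v] by simp
      have "(if ug_source \<G> e \<in> {v} then Y e else 0) * sG e \<in> lpa_null" if e: "e \<in> E" for e
      proof (cases "ug_source \<G> e = v")
        case True
        have eE: "e \<in> edges \<G>" using e E by blast
        have "x0 * (pP {v} * sE e) \<approx>\<^sub>L x0 * sE e"
          using lpa_rel_source_edge[OF eE] unfolding True by (intro lpa_cong_mult lpa_cong_refl)
        moreover have "x0 * (pP {v} * sE e) \<in> lpa_null"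
          using lpa_null_mult(1)[OF x0v_null] by (simp add: mult.assoc)
        ultimately have "x0 * sE e \<in> lpa_null" using lpa_null_cong by blast
        moreover have "x0 * sE e + Y e * pP (ug_range \<G> e) \<in> lpa_null"
          using lpa_null_cong[OF level_decomp_edge[OF E x eE]] edge[OF eE] e by simp
        ultimately have "x0 * sE e + Y e * pP (ug_range \<G> e) - x0 * sE e \<in> lpa_null"
          by (intro lpa_null_diff)
        then have "Y e * pP (ug_range \<G> e) \<in> lpa_null" by simp
        then have "Y e * (pP (ug_range \<G> e) * sG e) \<in> lpa_null"
          unfolding mult.assoc[symmetric] by (rule lpa_null_mult)
        moreover have "Y e * (pP (ug_range \<G> e) * sG e) \<approx>\<^sub>L Y e * sG e"
          using eE by (intro lpa_cong_mult lpa_cong_refl lpa_rel_range_ghost)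
        ultimately have "Y e * sG e \<in> lpa_null" using lpa_null_cong by blast
        then show ?thesis using True by simp
      qed simp
      then have "x0 * pP {v} + (\<Sum>e\<in>E. (if ug_source \<G> e \<in> {v} then Y e else 0) * sG e) \<in> lpa_null"
        by (intro lpa_null_add x0v_null lpa_null_sum)
      then show ?thesis using lpa_null_cong[OF xv] by simp
    qed
  qed
  \<comment> \<open>The set \<open>?V\<close> contains the source of every ghost edge in the
    decomposition, so \<open>p_V\<close> fixes all ghost terms on the right and they cancel in
    \<open>x - x p_V\<close>.\<close>
  let ?V = "ug_source \<G> ` E"
  let ?l = "map (\<lambda>(k, \<alpha>, A). (k, \<alpha>, A - ?V)) l"
  have V: "finite ?V" "?V \<subseteq> verts \<G>" using E source_in_verts by auto
  then have Vg: "?V \<in> gen_verts \<G>" by (rule finite_gen_verts)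
  have xV: "x * pP ?V \<in> lpa_null" by (rule mult_finite_proj_null[OF V vertex]) (use V(2) in blast)
  have "x * pP ?V \<approx>\<^sub>L x0 * pP ?V + (\<Sum>e\<in>E. (if ug_source \<G> e \<in> ?V then Y e else 0) * sG e)"
    using E(2) x Vg by (rule level_decomp_proj)
  also have "(\<Sum>e\<in>E. (if ug_source \<G> e \<in> ?V then Y e else 0) * sG e) = (\<Sum>e\<in>E. Y e * sG e)"
    by (rule sum.cong) auto
  finally have "x - x * pP ?V \<approx>\<^sub>L
      (x0 + (\<Sum>e\<in>E. Y e * sG e)) - (x0 * pP ?V + (\<Sum>e\<in>E. Y e * sG e))"
    by (intro lpa_cong_diff x)
  then have "x - x * pP ?V \<approx>\<^sub>L x0 - x0 * pP ?V" by simp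
  also have "\<dots> \<approx>\<^sub>L comb l - comb l * pP ?V"
    using l(2) by (intro lpa_cong_diff lpa_cong_mult lpa_cong_refl)
  also have "\<dots> \<approx>\<^sub>L comb ?l" using l(1) Vg by (rule comb_minus_proj)
  finally have xl: "x - x * pP ?V \<approx>\<^sub>L comb ?l" .
  \<comment> \<open>The multiplier has a constant term and lies outside the carrier; the hypothesis
    quantifies over all \<open>b\<close> of the type in order to allow it.\<close>
  then have "x * (1 - pP ?V) \<approx>\<^sub>L comb ?l" by (simp add: right_diff_distrib)
  then have "comb ?l \<in> lpa_null" using Suc.prems(2) admissible_diff[OF l(1) Vg] by blast
  then have "x - x * pP ?V \<in> lpa_null" using lpa_null_cong[OF xl] by simp
  from lpa_null_add[OF this xV] show ?case by simp
qed

lemma exists_real_multiple: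
  assumes "x \<in> carrier (lpa_free \<G>)" "x \<notin> lpa_null"
  obtains b l \<alpha> v where "admissible l" "x * b \<approx>\<^sub>L comb l" "coef l \<alpha> v \<noteq> 0"
proof -
  obtain n where "x \<in> level n" using carrier_level[OF assms(1)] by blast
  then obtain b l where "admissible l" "x * b \<approx>\<^sub>L comb l" "comb l \<notin> lpa_null"
    using lpa_null_if_real_multiples_null assms(2) by blast
  then show thesis using comb_null[of l] that by blast
qed

text \<open>Multiplying by an edge \<open>e\<close> moves the coefficient of \<alpha> at its source
  to \<alpha> followed by \<open>e\<close>, at every vertex of the range. Distinct paths remain
  distinct, so nothing cancels, and the next source, or finally \<open>u\<close>, can be chosen as
  that vertex.\<close>

lemma real_multiple_along_path:
  assumes "edge_path \<G> \<mu>" "u \<in> ug_range \<G> (last \<mu>)" "admissible l" "x * b \<approx>\<^sub>L comb l"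
    "coef l \<alpha> (ug_source \<G> (hd \<mu>)) \<noteq> 0"
  shows "\<exists>b' l' \<alpha>'. admissible l' \<and> x * b' \<approx>\<^sub>L comb l' \<and> coef l' \<alpha>' u \<noteq> 0"
  using assms
proof (induction \<mu> arbitrary: b l \<alpha>)
  case (Cons e \<mu>)
  have e: "e \<in> edges \<G>" using Cons.prems(1) by (simp add: edge_path_Cons)
  have adm: "admissible (append_edge e l)" using Cons.prems(3) e by (rule admissible_append_edge)
  have "x * (b * sE e) \<approx>\<^sub>L comb l * sE e"
    unfolding mult.assoc[symmetric] using Cons.prems(4) by (intro lpa_cong_mult lpa_cong_refl)
  also have "\<dots> \<approx>\<^sub>L comb (append_edge e l)" using Cons.prems(3) e by (rule comb_mult_edge)
  finally have x: "x * (b * sE e) \<approx>\<^sub>L comb (append_edge e l)" .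
  have coef: "coef (append_edge e l) (\<alpha> @ [e]) w \<noteq> 0" if "w \<in> ug_range \<G> e" for w
    using coef_append_edge[OF that, of l \<alpha>] Cons.prems(5) by simp
  show ?case
  proof (cases "\<mu> = []")
    case True
    then show ?thesis using adm x coef[of u] Cons.prems(2) by auto
  next
    case False
    then have "edge_path \<G> \<mu>" "ug_source \<G> (hd \<mu>) \<in> ug_range \<G> e" "u \<in> ug_range \<G> (last \<mu>)"
      using Cons.prems(1,2) by (auto simp: edge_path_Cons)
    then show ?thesis using Cons.IH[OF _ _ adm x coef] by blast
  qed
qed (simp add: edge_path_def)

lemma real_multiple_reaches:
  assumes "reaches \<G> v u" "admissible l" "x * b \<approx>\<^sub>L comb l" "coef l \<alpha> v \<noteq> 0"
  obtains b' l' \<alpha>' where "admissible l'" "x * b' \<approx>\<^sub>L comb l'" "coef l' \<alpha>' u \<noteq> 0"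
  using assms real_multiple_along_path[of _ u l x b \<alpha>] unfolding reaches_def by blast

lemma exists_shortest:
  assumes "coef l \<alpha> u \<noteq> 0"
  obtains \<beta> where "coef l \<beta> u \<noteq> 0" "\<And>\<gamma>. coef l \<gamma> u \<noteq> 0 \<Longrightarrow> length \<beta> \<le> length \<gamma>"
  using ex_has_least_nat[of "\<lambda>\<beta>. coef l \<beta> u \<noteq> 0" \<alpha> length] assms by blast

text \<open>With \<open>\<alpha>\<close> and \<open>\<beta>\<close> of minimal length among the paths that occur at \<open>u\<close>, the product with
  \<open>p\<^sub>u s\<^sub>\<beta>\<^sup>*\<close> in the middle has lowest term a nonzero multiple of \<open>s\<^sub>\<alpha> p\<^sub>u\<close>, and the degree separates it
  from the other terms.\<close>

lemma comb_product_not_null: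
  assumes l: "admissible l" "coef l \<alpha>0 u \<noteq> 0" and l': "admissible l'" "coef l' \<beta>0 u \<noteq> 0"
  shows "\<exists>c. comb l * c * comb l' \<notin> lpa_null"
proof -
  obtain \<alpha> where \<alpha>: "coef l \<alpha> u \<noteq> 0" "\<And>\<gamma>. coef l \<gamma> u \<noteq> 0 \<Longrightarrow> length \<alpha> \<le> length \<gamma>"
    using l(2) by (rule exists_shortest) blast
  obtain \<beta> where \<beta>: "coef l' \<beta> u \<noteq> 0" "\<And>\<gamma>. coef l' \<gamma> u \<noteq> 0 \<Longrightarrow> length \<beta> \<le> length \<gamma>"
    using l'(2) by (rule exists_shortest) blast
  have p\<alpha>: "path_to \<alpha> {u}" and p\<beta>: "path_to \<beta> {u}" and u: "u \<in> verts \<G>"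
    using coef_nonzero_path[OF l(1) \<alpha>(1)] coef_nonzero_path[OF l'(1) \<beta>(1)] by auto
  let ?y = "(u, 0, 0) :: 'v \<times> nat \<times> int"
  let ?c = "pP {u} * Poly_Mapping.single (map Ghost (rev \<beta>)) 1"
  define h' where "h' = rep (comb l') (\<lambda>z. if z = ?y then 1 else 0)"
  define h where "h = rep ?c h'"
  have h: "h y = (if fst y = u then h' (foldr extend \<beta> y) else 0)" for y
    using u act_ghost_path[of \<beta> y] p\<beta>
    by (auto simp: h_def rep_mult rep_gen rep_single gen_verts.vertex)
  have h_y: "h ?y = coef l' \<beta> u"
    using rep_comb_extend[OF l'(1), of \<beta> ?y] p\<beta> by (simp add: h h'_def)
  \<comment> \<open>A path \<gamma> leading from \<beta> in front of \<open>y\<close> to the point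
    \<open>?y\<close> of degree 0 has length equal to the degree of \<open>y\<close> plus the length
    of \<beta>. If \<open>y\<close> has negative degree, \<gamma> is shorter than \<beta>, and
    minimality of \<beta> makes its coefficient at \<open>u\<close> vanish.\<close>
  have h_neg: "h y = 0" if "snd (snd y) < 0" for y
  proof (cases "fst y = u")
    case True
    let ?\<Gamma> = "(\<lambda>(k, \<alpha>, A). \<alpha>) ` set l'"
    have "partial_eval (\<lambda>z. coef l' \<gamma> (fst z) * (if z = ?y then 1 else 0))
        (act_word (map Edge \<gamma>) (foldr extend \<beta> y)) = 0" for \<gamma>
    proof (cases "act_word (map Edge \<gamma>) (foldr extend \<beta> y) = Some ?y")
      case T: True
      have "length \<gamma> < length \<beta>"
        using act_path_degree[OF T] that by (simp add: degree_foldr_extend)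
      then show ?thesis using T \<beta>(2)[of \<gamma>] by fastforce
    next
      case False
      then show ?thesis by (cases "act_word (map Edge \<gamma>) (foldr extend \<beta> y)") auto
    qed
    then show ?thesis
      using True rep_comb[OF l'(1), of ?\<Gamma>] by (simp add: h h'_def)
  qed (simp add: h)
  let ?\<Gamma> = "insert \<alpha> ((\<lambda>(k, \<alpha>, A). \<alpha>) ` set l)"
  let ?x = "foldr extend \<alpha> ?y"
  have x: "act_word (map Edge \<alpha>) ?x = Some ?y" using p\<alpha> by (intro act_path_extend) simp
  \<comment> \<open>The degree of \<open>?x\<close> is the length of \<alpha>. Another path \<gamma>
    with a nonzero coefficient at \<open>u\<close> is at least as long, and by uniqueness strictly
    longer, so it ends in negative degree, where \<open>h\<close> vanishes.\<close>
  have *: "partial_eval (\<lambda>z. coef l \<gamma> (fst z) * h z) (act_word (map Edge \<gamma>) ?x)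
      = (if \<gamma> = \<alpha> then coef l \<alpha> u * coef l' \<beta> u else 0)" for \<gamma>
  proof (cases "act_word (map Edge \<gamma>) ?x")
    case None
    then show ?thesis using x by auto
  next
    case (Some z)
    show ?thesis
    proof (cases "\<gamma> = \<alpha>")
      case True
      then have z: "z = ?y" using Some x by simp
      show ?thesis using True Some h_y unfolding z by simp
    next
      case False
      have "coef l \<gamma> (fst z) * h z = 0"
      proof (cases "fst z = u \<and> coef l \<gamma> u \<noteq> 0")
        case True
        have "length \<gamma> \<noteq> length \<alpha>" using act_path_unique[OF Some x] False by blast
        then have "length \<alpha> < length \<gamma>" using \<alpha>(2)[of \<gamma>] True by simp
        then have "snd (snd z) < 0"
          using act_path_degree[OF Some] by (simp add: degree_foldr_extend)
        then show ?thesis by (simp add: h_neg)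
      qed (auto simp: h)
      then show ?thesis using Some False by simp
    qed
  qed
  have \<Gamma>: "finite ?\<Gamma>" "(\<lambda>(k, \<alpha>, A). \<alpha>) ` set l \<subseteq> ?\<Gamma>" by (simp, rule subset_insertI)
  have "rep (comb l) h ?x = (\<Sum>\<gamma>\<in>?\<Gamma>. if \<gamma> = \<alpha> then coef l \<alpha> u * coef l' \<beta> u else 0)"
    by (simp only: rep_comb[OF l(1) \<Gamma>] *)
  also have "\<dots> = coef l \<alpha> u * coef l' \<beta> u" using \<Gamma>(1) by simp
  finally have "rep (comb l * ?c * comb l') (\<lambda>z. if z = ?y then 1 else 0) ?x \<noteq> 0"
    using \<alpha>(1) \<beta>(1) by (simp add: rep_mult[of "comb l * ?c"] rep_mult[of "comb l" ?c] flip: h'_def h_def)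
  then show ?thesis using rep_lpa_null by blast
qed

lemma prime_ring_if_downward_directed:
  assumes "downward_directed \<G>"
  shows "prime_ring (leavitt_path_algebra \<G> :: (('v, 'e) lpa_gen list \<Rightarrow>\<^sub>0 'k::field) set ring)"
proof -
  let ?F = "lpa_free \<G> :: ('k, ('v, 'e) lpa_gen list \<Rightarrow>\<^sub>0 'k) module"
  interpret F: nonunital_ring ?F by (simp add: lpa_free_def free_algebra_nonunital_ring)
  have mult: "x \<otimes>\<^bsub>?F\<^esub> y = x * y" for x y by (simp add: lpa_free_def free_algebra_def)
  show ?thesis
    unfolding leavitt_path_algebra_def
  proof (rule F.quot_prime_ringI[OF two_sided_ideal_lpa_ideal], unfold mult)
    fix x y assume x: "x \<in> carrier ?F" and y: "y \<in> carrier ?F"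
      and xy: "x * y \<in> lpa_ideal \<G>" "\<And>a. a \<in> carrier ?F \<Longrightarrow> x * a * y \<in> lpa_ideal \<G>"
    show "x \<in> lpa_ideal \<G> \<or> y \<in> lpa_ideal \<G>"
    proof (rule ccontr)
      assume "\<not> ?thesis"
      then have nn: "x \<notin> lpa_null" "y \<notin> lpa_null" using x y by (simp_all add: lpa_null_carrier)
      obtain b l \<alpha> v where b: "admissible l" "x * b \<approx>\<^sub>L comb l" "coef l \<alpha> v \<noteq> 0"
        using x nn(1) by (rule exists_real_multiple)
      obtain d m \<beta> w where d: "admissible m" "y * d \<approx>\<^sub>L comb m" "coef m \<beta> w \<noteq> 0"
        using y nn(2) by (rule exists_real_multiple)
      have "v \<in> verts \<G>" "w \<in> verts \<G>"
        using coef_nonzero_path(2)[OF b(1,3)] coef_nonzero_path(2)[OF d(1,3)] .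
      then obtain u where u: "reaches \<G> v u" "reaches \<G> w u"
        using assms unfolding downward_directed_def by blast
      obtain b' l' \<alpha>' where b': "admissible l'" "x * b' \<approx>\<^sub>L comb l'" "coef l' \<alpha>' u \<noteq> 0"
        using u(1) b by (rule real_multiple_reaches)
      obtain d' m' \<beta>' where d': "admissible m'" "y * d' \<approx>\<^sub>L comb m'" "coef m' \<beta>' u \<noteq> 0"
        using u(2) d by (rule real_multiple_reaches)
      obtain c where c: "comb l' * c * comb m' \<notin> lpa_null"
        using comb_product_not_null[OF b'(1,3) d'(1,3)] by blast
      \<comment> \<open>Both multipliers stand on the right of their elements: \<open>b'\<close> is
        absorbed into the middle factor, and \<open>d'\<close> remains outside.\<close>
      have "x * (b' * c) * y * d' \<in> lpa_null"
        using lpa_null_sandwich[OF x y xy] by (rule lpa_null_mult)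
      moreover have "(x * b') * c * (y * d') \<approx>\<^sub>L comb l' * c * comb m'"
        using b'(2) d'(2) by (intro lpa_cong_mult lpa_cong_refl)
      ultimately show False using c by (simp add: lpa_null_cong mult.assoc)
    qed
  qed
qed

section \<open>Necessity of downward directedness\<close>

lemma reaches_edge:
  assumes "reaches \<G> w (ug_source \<G> e)" "e \<in> edges \<G>" "u \<in> ug_range \<G> e"
  shows "reaches \<G> w u"
proof (cases "w = ug_source \<G> e")
  case True
  then show ?thesis
    using assms unfolding reaches_def by (intro disjI2 exI[of _ "[e]"]) (simp add: edge_path_def)
next
  case False
  then obtain \<mu> where "edge_path \<G> \<mu>" "ug_source \<G> (hd \<mu>) = w"
    "ug_source \<G> e \<in> ug_range \<G> (last \<mu>)"
    using assms(1) unfolding reaches_def by blast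
  moreover from this have "\<mu> \<noteq> []" by (simp add: edge_path_def)
  ultimately show ?thesis
    using assms(2,3) unfolding reaches_def
    by (intro disjI2 exI[of _ "\<mu> @ [e]"]) (simp add: edge_path_snoc)
qed

text \<open>The set \<open>B\<close> is general because the induction changes it. It starts as
  \<open>{w}\<close>; a last ghost \<open>s_e\<^sup>*\<close> survives next to
  \<open>p\<^sub>B\<close> only if the source of \<open>e\<close> lies in \<open>B\<close>, and then
  the range of \<open>e\<close>, still reachable from \<open>w\<close>, takes the place of
  \<open>B\<close>. At level 0 a surviving \<open>p\<^sub>v s\<^sub>\<alpha> p\<^sub>A\<close> with
  \<open>A\<close> nonempty inside \<open>B\<close> would make a vertex of \<open>A\<close> a common
  descendant.\<close>

lemma sandwich_null_if_no_common_descendant: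
  fixes x :: "('v, 'e) lpa_gen list \<Rightarrow>\<^sub>0 'k::field"
  assumes v: "v \<in> verts \<G>" and no: "\<And>u. u \<in> verts \<G> \<Longrightarrow> reaches \<G> w u \<Longrightarrow> \<not> reaches \<G> v u"
  shows "x \<in> level n \<Longrightarrow> B \<in> gen_verts \<G> \<Longrightarrow> (\<And>u. u \<in> B \<Longrightarrow> reaches \<G> w u) \<Longrightarrow>
    pP {v} * x * pP B \<in> lpa_null"
proof (induction n arbitrary: x B)
  case 0
  obtain l where l: "admissible l" "x \<approx>\<^sub>L comb l" using 0(1) by (auto simp: real_span_def)
  have entry: "pP {v} * (Poly_Mapping.single (map Edge \<alpha>) k * pP A) \<in> lpa_null"
    if A: "A \<in> gen_verts \<G>" "path_to \<alpha> A" "A \<subseteq> B" for k :: 'k and \<alpha> A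
  proof (cases "A = {}")
    case True
    then show ?thesis
      using lpa_rel_empty lpa_null_mult(2) unfolding lpa_null_iff_cong[symmetric] by blast
  next
    case False
    then obtain u where u: "u \<in> A" by blast
    then have nv: "\<not> reaches \<G> v u"
      using no[of u] 0(3)[of u] A gen_verts_subset by blast
    show ?thesis
    proof (cases \<alpha>)
      case Nil
      have "v \<notin> A" using no[OF v] 0(3) A(3) unfolding reaches_def by blast
      then have "pP {v} * pP A \<approx>\<^sub>L pP {}"
        using lpa_rel_inter[OF gen_verts.vertex[OF v] A(1)] by simp
      then have "pP {v} * pP A \<in> lpa_null"
        unfolding lpa_null_iff_cong using lpa_rel_empty lpa_cong_trans by blast
      then have "Poly_Mapping.single [] k * (pP {v} * pP A) \<in> lpa_null" by (rule lpa_null_mult)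
      then show ?thesis using Nil
        by (simp add: mult.assoc[symmetric] single_Nil_commute)
    next
      case (Cons e \<alpha>')
      have "reaches \<G> v u" if "ug_source \<G> e = v"
        using that A(2) u Cons unfolding reaches_def path_to_def
        by (intro disjI2 exI[of _ \<alpha>]) auto
      then have "ug_source \<G> e \<noteq> v" using nv by blast
      moreover have e: "e \<in> edges \<G>" using A(2) Cons by (simp add: path_to_Cons)
      ultimately have "pP {v} * sE e \<in> lpa_null"
        using proj_mult_edge[OF e gen_verts.vertex[OF v]] by (simp add: lpa_null_iff_cong)
      then have "pP {v} * sE e * (Poly_Mapping.single (map Edge \<alpha>') k * pP A) \<in> lpa_null"
        by (rule lpa_null_mult)
      moreover have "sE e * Poly_Mapping.single (map Edge \<alpha>') k =
          Poly_Mapping.single (map Edge \<alpha>) k"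
        using Cons by (simp add: gen_def mult_single plus_list_def)
      ultimately show ?thesis by (metis mult.assoc)
    qed
  qed
  have comb: "pP {v} * comb m \<in> lpa_null"
    if "\<forall>(k, \<alpha>, A)\<in>set m. A \<in> gen_verts \<G> \<and> path_to \<alpha> A \<and> A \<subseteq> B" for m :: "('k \<times> 'e list \<times> 'v set) list"
    using that
  proof (induction m)
    case (Cons t m)
    then show ?case
      by (cases t) (auto simp: distrib_left intro!: lpa_null_add entry)
  qed simp
  \<comment> \<open>Absorbing \<open>p\<^sub>B\<close> into the list puts every set inside
    \<open>B\<close>, as \<open>entry\<close> requires.\<close>
  let ?l = "map (\<lambda>(k, \<alpha>, A). (k, \<alpha>, A \<inter> B)) l"
  have "x * pP B \<approx>\<^sub>L comb l * pP B" using l by (intro lpa_cong_mult lpa_cong_refl)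
  also have "\<dots> \<approx>\<^sub>L comb ?l" using l(1) 0(2) by (rule comb_mult_proj)
  finally have "pP {v} * (x * pP B) \<approx>\<^sub>L pP {v} * comb ?l"
    by (intro lpa_cong_mult lpa_cong_refl)
  moreover have "pP {v} * comb ?l \<in> lpa_null"
    using admissible_inter[OF l(1) 0(2)] by (intro comb) (auto simp: admissible_def)
  ultimately show ?case by (simp add: lpa_null_cong mult.assoc)
next
  case (Suc n)
  obtain x0 E Y where x0: "x0 \<in> real_span" and E: "finite E" "E \<subseteq> edges \<G>"
    and Y: "\<forall>e\<in>E. Y e \<in> level n"
    and x: "x \<approx>\<^sub>L x0 + (\<Sum>e\<in>E. Y e * sG e)" using Suc.prems(1) by (rule level_SucE)
  have "pP {v} * (x * pP B) \<approx>\<^sub>L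
      pP {v} * (x0 * pP B + (\<Sum>e\<in>E. (if ug_source \<G> e \<in> B then Y e else 0) * sG e))"
    using E x Suc.prems(2) by (intro lpa_cong_mult lpa_cong_refl level_decomp_proj)
  moreover have "pP {v} * x0 * pP B \<in> lpa_null"
    using x0 real_span_level Suc.prems(2,3) by (intro Suc.IH) auto
  moreover have "pP {v} * ((if ug_source \<G> e \<in> B then Y e else 0) * sG e) \<in> lpa_null"
    if e: "e \<in> E" for e
  proof (cases "ug_source \<G> e \<in> B")
    case True
    have eE: "e \<in> edges \<G>" using e E by blast
    have "pP {v} * Y e * pP (ug_range \<G> e) \<in> lpa_null"
      using Suc.prems(3)[OF True] eE
      by (intro Suc.IH bspec[OF Y e] gen_verts.range) (auto intro: reaches_edge)
    then have "pP {v} * Y e * pP (ug_range \<G> e) * sG e \<in> lpa_null" by (rule lpa_null_mult)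
    moreover have "pP {v} * Y e * (pP (ug_range \<G> e) * sG e) \<approx>\<^sub>L pP {v} * Y e * sG e"
      using eE by (intro lpa_cong_mult lpa_cong_refl lpa_rel_range_ghost)
    ultimately show ?thesis using True by (simp add: lpa_null_cong mult.assoc)
  qed simp
  then have "(\<Sum>e\<in>E. pP {v} * ((if ug_source \<G> e \<in> B then Y e else 0) * sG e)) \<in> lpa_null"
    by (rule lpa_null_sum)
  ultimately show ?case
    by (simp add: lpa_null_cong distrib_left sum_distrib_left mult.assoc lpa_null_add)
qed

lemma vertex_not_null:
  assumes "v \<in> verts \<G>"
  shows "pP {v} \<notin> lpa_null"
proof
  assume "pP {v} \<in> lpa_null"
  from rep_lpa_null[OF this, of "\<lambda>_. 1" "(v, 0, 0)"] show False
    using assms by (simp add: rep_gen gen_verts.vertex)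
qed

lemma downward_directed_if_prime_ring:
  assumes "prime_ring (leavitt_path_algebra \<G> :: (('v, 'e) lpa_gen list \<Rightarrow>\<^sub>0 'k::field) set ring)"
  shows "downward_directed \<G>"
proof (rule ccontr)
  assume "\<not> downward_directed \<G>"
  then obtain v w where v: "v \<in> verts \<G>" and w: "w \<in> verts \<G>"
    and no: "\<And>u. u \<in> verts \<G> \<Longrightarrow> reaches \<G> w u \<Longrightarrow> \<not> reaches \<G> v u"
    unfolding downward_directed_def by blast
  let ?F = "lpa_free \<G> :: ('k, ('v, 'e) lpa_gen list \<Rightarrow>\<^sub>0 'k) module"
  interpret F: nonunital_ring ?F by (simp add: lpa_free_def free_algebra_nonunital_ring)
  have mult: "x \<otimes>\<^bsub>?F\<^esub> y = x * y" "x \<oplus>\<^bsub>?F\<^esub> y = x + y" for x y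
    by (simp_all add: lpa_free_def free_algebra_def)
  have P: "pP {z} \<in> carrier ?F" if "z \<in> verts \<G>" for z
    using that unfolding lpa_free_def
    by (intro free_algebra_closed) (simp add: lpa_gens_def gen_verts.vertex)
  have idem: "pP {v} * pP {v} - pP {v} \<in> (lpa_ideal \<G> :: (('v, 'e) lpa_gen list \<Rightarrow>\<^sub>0 'k) set)"
  proof -
    have "pP {v} * pP {v} \<approx>\<^sub>L (pP {v} :: ('v, 'e) lpa_gen list \<Rightarrow>\<^sub>0 'k)"
      using lpa_rel_inter[OF gen_verts.vertex[OF v] gen_verts.vertex[OF v]] by simp
    moreover have "pP {v} * pP {v} - pP {v} \<in> carrier ?F"
      using P[OF v] unfolding lpa_free_def by (intro free_algebra_closed(4,5))
    ultimately show ?thesis using lpa_null_carrier unfolding lpa_cong_def by blast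
  qed
  have "pP {v} \<in> (lpa_ideal \<G> :: (('v, 'e) lpa_gen list \<Rightarrow>\<^sub>0 'k) set) \<or>
      pP {w} \<in> (lpa_ideal \<G> :: (('v, 'e) lpa_gen list \<Rightarrow>\<^sub>0 'k) set)"
  proof (rule F.quot_prime_ring_idempotentD[OF two_sided_ideal_lpa_ideal
        assms[unfolded leavitt_path_algebra_def]], unfold mult)
    show "pP {v} * pP {v} \<in> lpa_ideal \<G> +>\<^bsub>?F\<^esub> pP {v}"
      unfolding a_r_coset_def' mult using idem by force
    fix a assume a: "a \<in> carrier ?F"
    then obtain n where "a \<in> level n" using carrier_level by blast
    then have "pP {v} * a * pP {w} \<in> lpa_null"
      using no v w by (intro sandwich_null_if_no_common_descendant[where w = w])
        (auto intro: gen_verts.vertex simp: reaches_def[of \<G> w w])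
    moreover have "pP {v} * a * pP {w} \<in> carrier ?F"
      using F.nu_m_closed P[OF v] P[OF w] a unfolding mult by blast
    ultimately show "pP {v} * a * pP {w} \<in> lpa_ideal \<G>" by (simp add: lpa_null_carrier)
  qed (use P v w in auto)
  then show False
    using vertex_not_null v w P lpa_null_carrier by blast
qed

end

theorem theorem3p2:
  fixes \<G> :: "('v, 'e) ultragraph"
  assumes "ultragraph \<G>"
  shows "prime_ring (leavitt_path_algebra \<G> :: (('v, 'e) lpa_gen list \<Rightarrow>\<^sub>0 'k::field) set ring)
    \<longleftrightarrow> downward_directed \<G>"
  using ultragraph.prime_ring_if_downward_directed[OF assms]
    ultragraph.downward_directed_if_prime_ring[OF assms]
  by blast

end
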